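(* For any programs $\Pi_1$ and $\Pi_2$ of mini-gringo with counting, if the sentence $\tau^*\Pi_1\leftrightarrow\tau^*\Pi_2$ is provable in the deductive system $\mathit{HT}_{\#}$, then $\Pi_1$ and $\Pi_2$ are strongly equivalent.
   Context: Precomputed terms. Fix a totally ordered set of precomputed terms containing all numerals $\overline n$ (one for each integer $n$, in 1-1 correspondence with the integers), all symbolic constants, and possibly other symbols, such that numerals are contiguous (every precomputed term between two numerals is a numeral) and are ordered as the integers. Programs (mini-gringo with counting). Program terms are built from precomputed terms and variables using unary $|\cdot|$ and binary $+,-,\times,/,\backslash,..$ (interval). An atom is a symbolic constant $p$ optionally followed by a parenthesized tuple of terms; a literal is an atom possibly preceded by one or two occurrences of $\mathit{not}$; a comparison is $t_1\prec t_2$ with $\prec$ one of $=,\neq,<,>,\le,\ge$. An aggregate element is $\mathbf X:\mathbf L$ where $\mathbf X$ is a tuple of distinct variables and $\mathbf L$ is a conjunction of literals and comparisons in which every member of $\mathbf X$ occurs. An aggregate atom is $\mathit{count}\{E\}\ge t$ or $\mathit{count}\{E\}\le t$ with $E$ an aggregate element and $t$ a term not containing $..$. A rule is $\mathit{Head}\leftarrow\mathit{Body}$ where $\mathit{Body}$ is a (possibly empty) conjunction of literals, comparisons and aggregate atoms, and $\mathit{Head}$ is an atom (basic rule), an atom in braces (choice rule), or empty (constraint). A variable of a rule is local if each of its occurrences is inside an aggregate element, global otherwise; a rule is pure if for every aggregate element $\mathbf X:\mathbf L$ in its body all members of $\mathbf X$ are local. A program is a finite set of pure rules. Semantics. A precomputed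 atom is $p(\mathbf t)$ with all members of $\mathbf t$ precomputed terms. The semantics of mini-gringo with counting (Lifschitz 2022) uses a translation $\tau$ mapping each pure rule $R$ to an infinitary propositional formula $\tau R$ built from precomputed atoms (e.g. $q\leftarrow\mathit{count}\{X:p(X)\}\le 5$ becomes $(\bigwedge_{\Delta:|\Delta|>5}\neg\bigwedge_{x\in\Delta}p(x))\to q$, $\Delta$ ranging over finite sets of precomputed terms); $\tau\Pi$ is the conjunction of $\tau R$ over rules $R$ of $\Pi$. Stable models of $\Pi$ are the stable models of $\tau\Pi$ in the sense of Truszczyński (2012). Programs $\Pi_1,\Pi_2$ are strongly equivalent if for every set $\Phi$ of infinitary propositional formulas built from precomputed atoms, $\{\tau\Pi_1\}\cup\Phi$ and $\{\tau\Pi_2\}\cup\Phi$ have the same stable models. Signatures. Formulas are two-sorted, with sort general and its subsort integer; integer variables are written $I,J,K,M,N$ (possibly with indices); program variables are general variables. Signature $\sigma_0$: numerals as integer object constants; other precomputed terms as general object constants; $|\cdot|$ (unary) and $+,-,\times$ (binary) as function constants on the integer sort; for each symbolic constant $p$ and $n\ge0$ an $n$-ary predicate constant $p/n$ with general arguments ($(p/n)(\mathbf t)$ is written $p(\mathbf t)$); binary predicate constants $\neq,<,>,\le,\ge$ with general arguments ($=$ is logical equality). Signature $\sigma_1$ adds, for every pair of disjoint lists $\mathbf X,\mathbf V$ of distinct general variables and every formula $F$ over $\sigma_0$ whose free variables are among $\mathbf X,\mathbf V$, predicate constants $\mathit{Atleast}^{\mathbf X;\mathbf V}_F$ and $\mathit{Atmost}^{\mathbf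 X;\mathbf V}_F$ with $|\mathbf V|+1$ general arguments. Signature $\sigma_2$ adds, for the same $\mathbf X,\mathbf V,F$, predicate constants $\mathit{Start}^{\mathbf X;\mathbf V}_F$ with $|\mathbf X|+|\mathbf V|+1$ arguments, the last of sort integer and the others general. Translation $\tau^*$. For a program term $t$ and a general variable $Z$ not in $t$, the formula $\mathit{val}_t(Z)$ over $\sigma_0$ is defined recursively ($I,J,K$ fresh integer variables): if $t$ is a precomputed term or variable, $Z=t$; if $t=|t_1|$, $\exists I(\mathit{val}_{t_1}(I)\wedge Z=|I|)$; if $t=t_1\,op\,t_2$ with $op\in\{+,-,\times\}$, $\exists IJ(\mathit{val}_{t_1}(I)\wedge\mathit{val}_{t_2}(J)\wedge Z=I\,op\,J)$; if $t=t_1/t_2$, $\exists IJK(\mathit{val}_{t_1}(I)\wedge\mathit{val}_{t_2}(J)\wedge K\times|J|\le|I|<(K+\overline1)\times|J|\wedge((I\times J\ge\overline0\wedge Z=K)\vee(I\times J<\overline0\wedge Z=-K)))$; if $t=t_1\backslash t_2$, the same with $Z=I-K\times J$ and $Z=I+K\times J$ in place of $Z=K$ and $Z=-K$; if $t=t_1..t_2$, $\exists IJK(\mathit{val}_{t_1}(I)\wedge\mathit{val}_{t_2}(J)\wedge I\le K\le J\wedge Z=K)$. For tuples, $\mathit{val}_{\mathbf t}(\mathbf Z)$ is the conjunction of the componentwise formulas. With fresh general variables: $\tau^B(p(\mathbf t))=\exists\mathbf Z(\mathit{val}_{\mathbf t}(\mathbf Z)\wedge p(\mathbf Z))$; $\tau^B(\mathit{not}\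 p(\mathbf t))=\exists\mathbf Z(\mathit{val}_{\mathbf t}(\mathbf Z)\wedge\neg p(\mathbf Z))$; $\tau^B(\mathit{not}\ \mathit{not}\ p(\mathbf t))=\exists\mathbf Z(\mathit{val}_{\mathbf t}(\mathbf Z)\wedge\neg\neg p(\mathbf Z))$; $\tau^B(t_1\prec t_2)=\exists Z_1Z_2(\mathit{val}_{t_1}(Z_1)\wedge\mathit{val}_{t_2}(Z_2)\wedge Z_1\prec Z_2)$; $\tau^B$ of a conjunction is the conjunction of the $\tau^B$ of its members. For a body element $B$: $B^*=\tau^B(B)$ if $B$ is a literal or comparison; if $B$ is $\mathit{count}\{\mathbf X:\mathbf L\}\ge t$ then $B^*=\exists C(\mathit{val}_t(C)\wedge\mathit{Atleast}^{\mathbf X;\mathbf V}_{\exists\mathbf W\tau^B(\mathbf L)}(\mathbf V,C))$, and for $\le$ the same with $\mathit{Atmost}$, where $C$ is a fresh general variable, $\mathbf V$ is the list of global variables occurring in $\mathbf L$, and $\mathbf W$ the list of local variables occurring in $\mathbf L$ not in $\mathbf X$. For a rule $H\leftarrow B_1\wedge\dots\wedge B_n$, $\tau^*$ of the rule is the universal closure of $B_1^*\wedge\dots\wedge B_n^*\wedge\mathit{val}_{\mathbf t}(\mathbf Z)\to p(\mathbf Z)$ if $H$ is $p(\mathbf t)$; of $B_1^*\wedge\dots\wedge B_n^*\wedge\mathit{val}_{\mathbf t}(\mathbf Z)\to p(\mathbf Z)\vee\neg p(\mathbf Z)$ if $H$ is $\{p(\mathbf t)\}$; of $\neg(B_1^*\wedge\dots\wedge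 B_n^* )$ if $H$ is empty ($\mathbf Z$ fresh general variables). $\tau^*\Pi$ is the conjunction of $\tau^*R$ for $R\in\Pi$. System $\mathit{HT}_{\#}$. $F^X_t$ denotes substitution of $t$ for the free occurrences of $X$ in $F$. For equal-length tuples of general variables, $(X_1,\dots,X_m)<(U_1,\dots,U_m)$ abbreviates $\bigvee_{l=1}^m(X_l<U_l\wedge\bigwedge_{k=1}^{l-1}X_k=U_k)$. An interpretation of $\sigma_0$ is standard if its general domain is the set of precomputed terms, its integer domain the set of numerals, every object constant denotes itself, $|\cdot|,+,-,\times$ have their arithmetic meaning, and $\neq,<,>,\le,\ge$ are interpreted by the total order on precomputed terms. $\mathit{Std}$ is the set of sentences over $\sigma_0$ containing no predicate symbol $p/n$ that are satisfied by standard interpretations. $D_0$ consists of, for all $\mathbf X,\mathbf V,F$ as in the definition of $\sigma_2$ and $\mathbf U$ a list of distinct general variables of the length of $\mathbf X$ disjoint from $\mathbf X$ and $\mathbf V$: $\forall\mathbf X\mathbf VN(N\le\overline0\to\mathit{Start}^{\mathbf X;\mathbf V}_F(\mathbf X,\mathbf V,N))$; $\forall\mathbf X\mathbf V(\mathit{Start}^{\mathbf X;\mathbf V}_F(\mathbf X,\mathbf V,\overline1)\leftrightarrow F)$; $\forall\mathbf X\mathbf VN(N>\overline0\to(\mathit{Start}^{\mathbf X;\mathbf V}_F(\mathbf X,\mathbf V,N+\overline1)\leftrightarrow F\wedge\exists\mathbf U(\mathbf X<\mathbf U\wedge\mathit{Start}^{\mathbf X;\mathbf V}_F(\mathbf U,\mathbf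 V,N))))$. $D_1$ consists of $\forall\mathbf VY(\mathit{Atleast}^{\mathbf X;\mathbf V}_F(\mathbf V,Y)\leftrightarrow\exists\mathbf XN(\mathit{Start}^{\mathbf X;\mathbf V}_F(\mathbf X,\mathbf V,N)\wedge N\ge Y))$ and $\forall\mathbf VY(\mathit{Atmost}^{\mathbf X;\mathbf V}_F(\mathbf V,Y)\leftrightarrow\forall\mathbf XN(\mathit{Start}^{\mathbf X;\mathbf V}_F(\mathbf X,\mathbf V,N)\to N\le Y))$ ($Y$ a general variable). $\mathit{Ind}$ is the set of universal closures of $F^N_{\overline0}\wedge\forall N(N\ge\overline0\wedge F\to F^N_{N+\overline1})\to\forall N(N\ge\overline0\to F)$ for formulas $F$ over $\sigma_2$. $\mathit{HT}_{\#}$ is first-order intuitionistic logic with equality for the two-sorted signature $\sigma_2$, extended by all formulas $F\vee(F\to G)\vee\neg G$ and $\exists X(F\to\forall X\,F)$ ($F,G$ over $\sigma_2$, $X$ a variable of either sort), and by the axioms $\mathit{Std}$, $\mathit{Ind}$, $D_0$, $D_1$. *)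

theory Defs
  imports Main
begin

text \<open>The precomputed terms form an arbitrary linearly ordered type 'c. The numerals are
  given by an order embedding num :: int => 'c whose range is convex (numerals are contiguous);
  symc is the set of symbolic constants (disjoint from the numerals).\<close>

definition precomp_ok :: "(int \<Rightarrow> 'c::linorder) \<Rightarrow> 'c set \<Rightarrow> bool" where
  "precomp_ok num symc \<longleftrightarrow> strict_mono num
     \<and> (\<forall>a b x. num a \<le> x \<and> x \<le> num b \<longrightarrow> x \<in> range num)
     \<and> symc \<inter> range num = {}"

datatype binop = BAdd | BSub | BMul | BDiv | BMod | BDots

datatype 'c pterm = PT 'c | PV nat | PAbs "'c pterm" | PBin binop "'c pterm" "'c pterm"

datatype 'c patom = PAtom 'c "'c pterm list"

datatype 'c plit = Pos "'c patom" | Neg "'c patom" | NegNeg "'c patom"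

datatype prel = REq | RNeq | RLt | RGt | RLe | RGe

datatype 'c lc = LLit "'c plit" | LCmp prel "'c pterm" "'c pterm"

datatype aggop = AGe | ALe

text \<open>body elements: literals/comparisons, or count{X : L} (>= | <=) t\<close>
datatype 'c belem = BL "'c lc" | BAgg "nat list" "'c lc list" aggop "'c pterm"

datatype 'c head = HBasic "'c patom" | HChoice "'c patom" | HNone

datatype 'c rule = Rule "'c head" "'c belem list"

fun pvars :: "'c pterm \<Rightarrow> nat set" where
  "pvars (PT c) = {}"
| "pvars (PV v) = {v}"
| "pvars (PAbs t) = pvars t"
| "pvars (PBin _ a b) = pvars a \<union> pvars b"

fun no_dots :: "'c pterm \<Rightarrow> bool" where
  "no_dots (PT c) = True"
| "no_dots (PV v) = True"
| "no_dots (PAbs t) = no_dots t"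
| "no_dots (PBin op a b) = (op \<noteq> BDots \<and> no_dots a \<and> no_dots b)"

fun avars :: "'c patom \<Rightarrow> nat set" where
  "avars (PAtom p ts) = \<Union> (pvars ` set ts)"

fun apred :: "'c patom \<Rightarrow> 'c" where
  "apred (PAtom p ts) = p"

fun litatom :: "'c plit \<Rightarrow> 'c patom" where
  "litatom (Pos a) = a" | "litatom (Neg a) = a" | "litatom (NegNeg a) = a"

fun lcvars :: "'c lc \<Rightarrow> nat set" where
  "lcvars (LLit l) = avars (litatom l)"
| "lcvars (LCmp r a b) = pvars a \<union> pvars b"

fun lc_preds :: "'c lc \<Rightarrow> 'c set" where
  "lc_preds (LLit l) = {apred (litatom l)}"
| "lc_preds (LCmp r a b) = {}"

fun hvars :: "'c head \<Rightarrow> nat set" where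
  "hvars (HBasic a) = avars a" | "hvars (HChoice a) = avars a" | "hvars HNone = {}"

fun h_preds :: "'c head \<Rightarrow> 'c set" where
  "h_preds (HBasic a) = {apred a}" | "h_preds (HChoice a) = {apred a}" | "h_preds HNone = {}"

fun bglob :: "'c belem \<Rightarrow> nat set" where
  "bglob (BL l) = lcvars l"
| "bglob (BAgg X L op t) = pvars t"

fun b_preds :: "'c belem \<Rightarrow> 'c set" where
  "b_preds (BL l) = lc_preds l"
| "b_preds (BAgg X L op t) = \<Union> (lc_preds ` set L)"

fun globals :: "'c rule \<Rightarrow> nat set" where
  "globals (Rule h B) = hvars h \<union> \<Union> (bglob ` set B)"

fun wf_belem :: "'c belem \<Rightarrow> bool" where
  "wf_belem (BL l) = True"
| "wf_belem (BAgg X L op t) = (distinct X \<and> set X \<subseteq> \<Union> (lcvars ` set L) \<and> no_dots t)"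

fun pure_rule :: "'c set \<Rightarrow> 'c rule \<Rightarrow> bool" where
  "pure_rule symc (Rule h B) =
     ((\<forall>b\<in>set B. wf_belem b)
      \<and> h_preds h \<union> \<Union> (b_preds ` set B) \<subseteq> symc
      \<and> (\<forall>X L op t. BAgg X L op t \<in> set B \<longrightarrow> set X \<inter> globals (Rule h B) = {}))"

definition program :: "'c set \<Rightarrow> 'c rule set \<Rightarrow> bool" where
  "program symc P \<longleftrightarrow> finite P \<and> (\<forall>R\<in>P. pure_rule symc R)"

text \<open>Terms are evaluated under an assignment \<sigma> of precomputed terms to variables; this is
  the same as taking the set of values of the ground instance obtained by substituting \<sigma>.\<close>

fun iop :: "binop \<Rightarrow> int \<Rightarrow> int \<Rightarrow> int option" where
  "iop BAdd a b = Some (a + b)"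
| "iop BSub a b = Some (a - b)"
| "iop BMul a b = Some (a * b)"
| "iop BDiv a b = (if b = 0 then None
     else Some (if a * b \<ge> 0 then \<bar>a\<bar> div \<bar>b\<bar> else - (\<bar>a\<bar> div \<bar>b\<bar>)))"
| "iop BMod a b = (if b = 0 then None
     else Some (if a * b \<ge> 0 then a - (\<bar>a\<bar> div \<bar>b\<bar>) * b else a + (\<bar>a\<bar> div \<bar>b\<bar>) * b))"
| "iop BDots a b = None"

fun pval :: "(int \<Rightarrow> 'c) \<Rightarrow> (nat \<Rightarrow> 'c) \<Rightarrow> 'c pterm \<Rightarrow> 'c set" where
  "pval num \<sigma> (PT c) = {c}"
| "pval num \<sigma> (PV v) = {\<sigma> v}"
| "pval num \<sigma> (PAbs t) = {num \<bar>n\<bar> | n. num n \<in> pval num \<sigma> t}"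
| "pval num \<sigma> (PBin op a b) =
     (if op = BDots then
        {num m | m n1 n2. num n1 \<in> pval num \<sigma> a \<and> num n2 \<in> pval num \<sigma> b \<and> n1 \<le> m \<and> m \<le> n2}
      else
        {num r | r n1 n2. num n1 \<in> pval num \<sigma> a \<and> num n2 \<in> pval num \<sigma> b \<and> iop op n1 n2 = Some r})"

definition pvals :: "(int \<Rightarrow> 'c) \<Rightarrow> (nat \<Rightarrow> 'c) \<Rightarrow> 'c pterm list \<Rightarrow> 'c list set" where
  "pvals num \<sigma> ts = listset (map (pval num \<sigma>) ts)"

fun rel_holds :: "prel \<Rightarrow> 'c::linorder \<Rightarrow> 'c \<Rightarrow> bool" where
  "rel_holds REq x y = (x = y)"
| "rel_holds RNeq x y = (x \<noteq> y)"
| "rel_holds RLt x y = (x < y)"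
| "rel_holds RGt x y = (x > y)"
| "rel_holds RLe x y = (x \<le> y)"
| "rel_holds RGe x y = (x \<ge> y)"

section \<open>Infinitary propositional formulas (Truszczynski 2012)\<close>

datatype ('a, 'i) iform = IBot | IAtm 'a
  | IAnd "'i set" "'i \<Rightarrow> ('a, 'i) iform"
  | IOr "'i set" "'i \<Rightarrow> ('a, 'i) iform"
  | IImp "('a, 'i) iform" "('a, 'i) iform"

primrec isat :: "'a set \<Rightarrow> ('a, 'i) iform \<Rightarrow> bool" where
  "isat I IBot = False"
| "isat I (IAtm a) = (a \<in> I)"
| "isat I (IAnd S f) = (\<forall>i\<in>S. isat I (f i))"
| "isat I (IOr S f) = (\<exists>i\<in>S. isat I (f i))"
| "isat I (IImp F G) = (isat I F \<longrightarrow> isat I G)"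

primrec reduct :: "'a set \<Rightarrow> ('a, 'i) iform \<Rightarrow> ('a, 'i) iform" where
  "reduct I IBot = IBot"
| "reduct I (IAtm a) = (if a \<in> I then IAtm a else IBot)"
| "reduct I (IAnd S f) = (if isat I (IAnd S f) then IAnd S (\<lambda>i. reduct I (f i)) else IBot)"
| "reduct I (IOr S f) = (if isat I (IOr S f) then IOr S (\<lambda>i. reduct I (f i)) else IBot)"
| "reduct I (IImp F G) = (if isat I (IImp F G) then IImp (reduct I F) (reduct I G) else IBot)"

definition stable :: "('a, 'i) iform set \<Rightarrow> 'a set \<Rightarrow> bool" where
  "stable H I \<longleftrightarrow> (\<forall>F\<in>H. isat I (reduct I F))
     \<and> (\<forall>J. J \<subseteq> I \<and> (\<forall>F\<in>H. isat J (reduct I F)) \<longrightarrow> J = I)"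

text \<open>Index objects used by tau; formulas are built with index type 'c ix + 'x where 'x is
  arbitrary (so that arbitrarily large conjunctions/disjunctions can occur in \<Phi>).\<close>
datatype 'c ix = IxRule "'c rule" | IxEnv "nat \<Rightarrow> 'c" | IxNat nat | IxTup "'c list"
  | IxSet "'c list set"

type_synonym ('c, 'x) inf = "('c \<times> 'c list, 'c ix + 'x) iform"

definition bigand :: "('v \<Rightarrow> 'c ix) \<Rightarrow> 'v set \<Rightarrow> ('v \<Rightarrow> ('c, 'x) inf) \<Rightarrow> ('c, 'x) inf" where
  "bigand e S f = IAnd (Inl ` e ` S)
     (\<lambda>i. case i of Inl j \<Rightarrow> (if j \<in> e ` S then f (inv_into S e j) else IBot) | Inr _ \<Rightarrow> IBot)"

definition bigor :: "('v \<Rightarrow> 'c ix) \<Rightarrow> 'v set \<Rightarrow> ('v \<Rightarrow> ('c, 'x) inf) \<Rightarrow> ('c, 'x) inf" where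
  "bigor e S f = IOr (Inl ` e ` S)
     (\<lambda>i. case i of Inl j \<Rightarrow> (if j \<in> e ` S then f (inv_into S e j) else IBot) | Inr _ \<Rightarrow> IBot)"

definition LAnd :: "('c, 'x) inf list \<Rightarrow> ('c, 'x) inf" where
  "LAnd Fs = bigand IxNat {..<length Fs} (\<lambda>n. Fs ! n)"

definition LOr :: "('c, 'x) inf list \<Rightarrow> ('c, 'x) inf" where
  "LOr Fs = bigor IxNat {..<length Fs} (\<lambda>n. Fs ! n)"

definition INeg :: "('a, 'i) iform \<Rightarrow> ('a, 'i) iform" where
  "INeg F = IImp F IBot"

definition ITop :: "('a, 'i) iform" where
  "ITop = IImp IBot IBot"

fun tau_lit :: "(int \<Rightarrow> 'c) \<Rightarrow> (nat \<Rightarrow> 'c) \<Rightarrow> 'c plit \<Rightarrow> ('c, 'x) inf" where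
  "tau_lit num \<sigma> (Pos (PAtom p ts)) = bigor IxTup (pvals num \<sigma> ts) (\<lambda>r. IAtm (p, r))"
| "tau_lit num \<sigma> (Neg (PAtom p ts)) = bigor IxTup (pvals num \<sigma> ts) (\<lambda>r. INeg (IAtm (p, r)))"
| "tau_lit num \<sigma> (NegNeg (PAtom p ts)) =
     bigor IxTup (pvals num \<sigma> ts) (\<lambda>r. INeg (INeg (IAtm (p, r))))"

fun tau_lc :: "(int \<Rightarrow> 'c::linorder) \<Rightarrow> (nat \<Rightarrow> 'c) \<Rightarrow> 'c lc \<Rightarrow> ('c, 'x) inf" where
  "tau_lc num \<sigma> (LLit l) = tau_lit num \<sigma> l"
| "tau_lc num \<sigma> (LCmp r a b) =
     (if \<exists>x\<in>pval num \<sigma> a. \<exists>y\<in>pval num \<sigma> b. rel_holds r x y then ITop else IBot)"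

text \<open>For an aggregate element X:L inside a rule with global variables G, instantiated by \<sigma>,
  and a tuple x: the disjunction over all values of the remaining local variables W.\<close>
definition aggG :: "(int \<Rightarrow> 'c::linorder) \<Rightarrow> nat set \<Rightarrow> (nat \<Rightarrow> 'c) \<Rightarrow> nat list \<Rightarrow> 'c lc list
    \<Rightarrow> 'c list \<Rightarrow> ('c, 'x) inf" where
  "aggG num G \<sigma> X L x = bigor IxEnv {\<rho>. (\<forall>v\<in>G. \<rho> v = \<sigma> v) \<and> map \<rho> X = x}
      (\<lambda>\<rho>. LAnd (map (tau_lc num \<rho>) L))"

definition tuple_sets :: "nat \<Rightarrow> 'c list set set" where
  "tuple_sets n = {\<Delta>. finite \<Delta> \<and> (\<forall>x\<in>\<Delta>. length x = n)}"

fun tau_agg :: "(int \<Rightarrow> 'c::linorder) \<Rightarrow> nat set \<Rightarrow> (nat \<Rightarrow> 'c) \<Rightarrow> nat list \<Rightarrow> 'c lc list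
    \<Rightarrow> aggop \<Rightarrow> 'c pterm \<Rightarrow> ('c, 'x) inf" where
  "tau_agg num G \<sigma> X L AGe t = bigor (\<lambda>r. IxTup [r]) (pval num \<sigma> t) (\<lambda>r.
      bigor IxSet {\<Delta>\<in>tuple_sets (length X). r \<le> num (int (card \<Delta>))}
        (\<lambda>\<Delta>. bigand IxTup \<Delta> (\<lambda>x. aggG num G \<sigma> X L x)))"
| "tau_agg num G \<sigma> X L ALe t = bigor (\<lambda>r. IxTup [r]) (pval num \<sigma> t) (\<lambda>r.
      bigand IxSet {\<Delta>\<in>tuple_sets (length X). \<not> num (int (card \<Delta>)) \<le> r}
        (\<lambda>\<Delta>. INeg (bigand IxTup \<Delta> (\<lambda>x. aggG num G \<sigma> X L x))))"

fun tau_belem :: "(int \<Rightarrow> 'c::linorder) \<Rightarrow> nat set \<Rightarrow> (nat \<Rightarrow> 'c) \<Rightarrow> 'c belem \<Rightarrow> ('c, 'x) inf" where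
  "tau_belem num G \<sigma> (BL l) = tau_lc num \<sigma> l"
| "tau_belem num G \<sigma> (BAgg X L op t) = tau_agg num G \<sigma> X L op t"

fun tau_inst :: "(int \<Rightarrow> 'c::linorder) \<Rightarrow> nat set \<Rightarrow> (nat \<Rightarrow> 'c) \<Rightarrow> 'c rule \<Rightarrow> ('c, 'x) inf" where
  "tau_inst num G \<sigma> (Rule (HBasic (PAtom p ts)) B) =
     IImp (LAnd (map (tau_belem num G \<sigma>) B)) (bigand IxTup (pvals num \<sigma> ts) (\<lambda>r. IAtm (p, r)))"
| "tau_inst num G \<sigma> (Rule (HChoice (PAtom p ts)) B) =
     IImp (LAnd (map (tau_belem num G \<sigma>) B))
       (bigand IxTup (pvals num \<sigma> ts) (\<lambda>r. LOr [IAtm (p, r), INeg (IAtm (p, r))]))"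
| "tau_inst num G \<sigma> (Rule HNone B) = INeg (LAnd (map (tau_belem num G \<sigma>) B))"

definition tau_rule :: "(int \<Rightarrow> 'c::linorder) \<Rightarrow> 'c rule \<Rightarrow> ('c, 'x) inf" where
  "tau_rule num R = bigand IxEnv UNIV (\<lambda>\<sigma>. tau_inst num (globals R) \<sigma> R)"

definition tau_prog :: "(int \<Rightarrow> 'c::linorder) \<Rightarrow> 'c rule set \<Rightarrow> ('c, 'x) inf" where
  "tau_prog num P = bigand IxRule P (tau_rule num)"

definition strongly_equiv :: "'x itself \<Rightarrow> (int \<Rightarrow> 'c::linorder) \<Rightarrow> 'c rule set \<Rightarrow> 'c rule set \<Rightarrow> bool" where
  "strongly_equiv _ num P1 P2 \<longleftrightarrow>
     (\<forall>(\<Phi> :: ('c, 'x) inf set) I.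
        stable (insert (tau_prog num P1) \<Phi>) I \<longleftrightarrow> stable (insert (tau_prog num P2) \<Phi>) I)"

text \<open>GV n: general variables, IV n: integer variables.\<close>
datatype fvar = GV nat | IV nat

datatype fop = FAdd | FSub | FMul

datatype 'c fterm = FVar fvar | FObj 'c | FAbs "'c fterm" | FBin fop "'c fterm" "'c fterm"

datatype crel = CNeq | CLt | CGt | CLe | CGe

text \<open>FP p ts is (p/n)(ts) with n = length ts; FAtleast X V F, FAtmost X V F, FStart X V F are the
  predicate constants Atleast^{X;V}_F etc. (F is part of the predicate symbol).\<close>
datatype 'c fform = FBot
  | FEq "'c fterm" "'c fterm"
  | FCmp crel "'c fterm" "'c fterm"
  | FP 'c "'c fterm list"
  | FAtleast "fvar list" "fvar list" "'c fform" "'c fterm list"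
  | FAtmost "fvar list" "fvar list" "'c fform" "'c fterm list"
  | FStart "fvar list" "fvar list" "'c fform" "'c fterm list"
  | FAnd "'c fform" "'c fform"
  | FOr "'c fform" "'c fform"
  | FImp "'c fform" "'c fform"
  | FAll fvar "'c fform"
  | FEx fvar "'c fform"

definition FNeg :: "'c fform \<Rightarrow> 'c fform" where "FNeg A = FImp A FBot"
definition FTop :: "'c fform" where "FTop = FImp FBot FBot"
definition FIff :: "'c fform \<Rightarrow> 'c fform \<Rightarrow> 'c fform" where
  "FIff A B = FAnd (FImp A B) (FImp B A)"

fun FAnds :: "'c fform list \<Rightarrow> 'c fform" where
  "FAnds [] = FTop" | "FAnds [A] = A" | "FAnds (A # As) = FAnd A (FAnds As)"

fun FOrs :: "'c fform list \<Rightarrow> 'c fform" where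
  "FOrs [] = FBot" | "FOrs [A] = A" | "FOrs (A # As) = FOr A (FOrs As)"

definition FAlls :: "fvar list \<Rightarrow> 'c fform \<Rightarrow> 'c fform" where
  "FAlls xs A = foldr FAll xs A"

definition FExs :: "fvar list \<Rightarrow> 'c fform \<Rightarrow> 'c fform" where
  "FExs xs A = foldr FEx xs A"

fun is_gvar :: "fvar \<Rightarrow> bool" where
  "is_gvar (GV n) = True" | "is_gvar (IV n) = False"

fun is_ivar :: "fvar \<Rightarrow> bool" where
  "is_ivar (GV n) = False" | "is_ivar (IV n) = True"

fun tvars :: "'c fterm \<Rightarrow> fvar set" where
  "tvars (FVar x) = {x}"
| "tvars (FObj c) = {}"
| "tvars (FAbs t) = tvars t"
| "tvars (FBin _ a b) = tvars a \<union> tvars b"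

fun tsubst :: "fvar \<Rightarrow> 'c fterm \<Rightarrow> 'c fterm \<Rightarrow> 'c fterm" where
  "tsubst x s (FVar y) = (if y = x then s else FVar y)"
| "tsubst x s (FObj c) = FObj c"
| "tsubst x s (FAbs t) = FAbs (tsubst x s t)"
| "tsubst x s (FBin op a b) = FBin op (tsubst x s a) (tsubst x s b)"

text \<open>free variables (the formula indexing a predicate symbol is not a subformula)\<close>
fun fv :: "'c fform \<Rightarrow> fvar set" where
  "fv FBot = {}"
| "fv (FEq a b) = tvars a \<union> tvars b"
| "fv (FCmp r a b) = tvars a \<union> tvars b"
| "fv (FP p ts) = \<Union> (tvars ` set ts)"
| "fv (FAtleast X V F ts) = \<Union> (tvars ` set ts)"
| "fv (FAtmost X V F ts) = \<Union> (tvars ` set ts)"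
| "fv (FStart X V F ts) = \<Union> (tvars ` set ts)"
| "fv (FAnd A B) = fv A \<union> fv B"
| "fv (FOr A B) = fv A \<union> fv B"
| "fv (FImp A B) = fv A \<union> fv B"
| "fv (FAll x A) = fv A - {x}"
| "fv (FEx x A) = fv A - {x}"

fun subst :: "fvar \<Rightarrow> 'c fterm \<Rightarrow> 'c fform \<Rightarrow> 'c fform" where
  "subst x s FBot = FBot"
| "subst x s (FEq a b) = FEq (tsubst x s a) (tsubst x s b)"
| "subst x s (FCmp r a b) = FCmp r (tsubst x s a) (tsubst x s b)"
| "subst x s (FP p ts) = FP p (map (tsubst x s) ts)"
| "subst x s (FAtleast X V F ts) = FAtleast X V F (map (tsubst x s) ts)"
| "subst x s (FAtmost X V F ts) = FAtmost X V F (map (tsubst x s) ts)"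
| "subst x s (FStart X V F ts) = FStart X V F (map (tsubst x s) ts)"
| "subst x s (FAnd A B) = FAnd (subst x s A) (subst x s B)"
| "subst x s (FOr A B) = FOr (subst x s A) (subst x s B)"
| "subst x s (FImp A B) = FImp (subst x s A) (subst x s B)"
| "subst x s (FAll y A) = (if y = x then FAll y A else FAll y (subst x s A))"
| "subst x s (FEx y A) = (if y = x then FEx y A else FEx y (subst x s A))"

fun free_for :: "'c fterm \<Rightarrow> fvar \<Rightarrow> 'c fform \<Rightarrow> bool" where
  "free_for s x (FAnd A B) = (free_for s x A \<and> free_for s x B)"
| "free_for s x (FOr A B) = (free_for s x A \<and> free_for s x B)"
| "free_for s x (FImp A B) = (free_for s x A \<and> free_for s x B)"
| "free_for s x (FAll y A) = (y = x \<or> x \<notin> fv A \<or> (y \<notin> tvars s \<and> free_for s x A))"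
| "free_for s x (FEx y A) = (y = x \<or> x \<notin> fv A \<or> (y \<notin> tvars s \<and> free_for s x A))"
| "free_for s x _ = True"

fun int_term :: "(int \<Rightarrow> 'c) \<Rightarrow> 'c fterm \<Rightarrow> bool" where
  "int_term num (FVar x) = is_ivar x"
| "int_term num (FObj c) = (c \<in> range num)"
| "int_term num (FAbs t) = int_term num t"
| "int_term num (FBin op a b) = (int_term num a \<and> int_term num b)"

fun gen_term :: "(int \<Rightarrow> 'c) \<Rightarrow> 'c fterm \<Rightarrow> bool" where
  "gen_term num (FVar x) = True"
| "gen_term num (FObj c) = True"
| "gen_term num t = int_term num t"

definition sort_ok :: "(int \<Rightarrow> 'c) \<Rightarrow> fvar \<Rightarrow> 'c fterm \<Rightarrow> bool" where
  "sort_ok num x t \<longleftrightarrow> (if is_ivar x then int_term num t else gen_term num t)"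

fun sig0 :: "'c fform \<Rightarrow> bool" where
  "sig0 (FAtleast X V F ts) = False"
| "sig0 (FAtmost X V F ts) = False"
| "sig0 (FStart X V F ts) = False"
| "sig0 (FAnd A B) = (sig0 A \<and> sig0 B)"
| "sig0 (FOr A B) = (sig0 A \<and> sig0 B)"
| "sig0 (FImp A B) = (sig0 A \<and> sig0 B)"
| "sig0 (FAll x A) = sig0 A"
| "sig0 (FEx x A) = sig0 A"
| "sig0 _ = True"

fun no_pn :: "'c fform \<Rightarrow> bool" where
  "no_pn (FP p ts) = False"
| "no_pn (FAnd A B) = (no_pn A \<and> no_pn B)"
| "no_pn (FOr A B) = (no_pn A \<and> no_pn B)"
| "no_pn (FImp A B) = (no_pn A \<and> no_pn B)"
| "no_pn (FAll x A) = no_pn A"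
| "no_pn (FEx x A) = no_pn A"
| "no_pn _ = True"

fun wff :: "(int \<Rightarrow> 'c) \<Rightarrow> 'c set \<Rightarrow> 'c fform \<Rightarrow> bool" where
  "wff num symc FBot = True"
| "wff num symc (FEq a b) = (gen_term num a \<and> gen_term num b)"
| "wff num symc (FCmp r a b) = (gen_term num a \<and> gen_term num b)"
| "wff num symc (FP p ts) = (p \<in> symc \<and> (\<forall>t\<in>set ts. gen_term num t))"
| "wff num symc (FAtleast X V F ts) =
     (distinct (X @ V) \<and> (\<forall>x\<in>set (X @ V). is_gvar x) \<and> sig0 F \<and> wff num symc F
      \<and> fv F \<subseteq> set X \<union> set V \<and> length ts = Suc (length V) \<and> (\<forall>t\<in>set ts. gen_term num t))"
| "wff num symc (FAtmost X V F ts) =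
     (distinct (X @ V) \<and> (\<forall>x\<in>set (X @ V). is_gvar x) \<and> sig0 F \<and> wff num symc F
      \<and> fv F \<subseteq> set X \<union> set V \<and> length ts = Suc (length V) \<and> (\<forall>t\<in>set ts. gen_term num t))"
| "wff num symc (FStart X V F ts) =
     (distinct (X @ V) \<and> (\<forall>x\<in>set (X @ V). is_gvar x) \<and> sig0 F \<and> wff num symc F
      \<and> fv F \<subseteq> set X \<union> set V \<and> length ts = Suc (length X + length V)
      \<and> (\<forall>t\<in>set (butlast ts). gen_term num t) \<and> int_term num (last ts))"
| "wff num symc (FAnd A B) = (wff num symc A \<and> wff num symc B)"
| "wff num symc (FOr A B) = (wff num symc A \<and> wff num symc B)"
| "wff num symc (FImp A B) = (wff num symc A \<and> wff num symc B)"
| "wff num symc (FAll x A) = wff num symc A"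
| "wff num symc (FEx x A) = wff num symc A"

definition is_ucl :: "'c fform \<Rightarrow> 'c fform \<Rightarrow> bool" where
  "is_ucl G A \<longleftrightarrow> (\<exists>xs. distinct xs \<and> set xs = fv A \<and> G = FAlls xs A)"

definition uclose :: "'c fform \<Rightarrow> 'c fform" where
  "uclose A = (SOME G. is_ucl G A)"

fun std_term :: "(int \<Rightarrow> 'c) \<Rightarrow> (fvar \<Rightarrow> 'c) \<Rightarrow> 'c fterm \<Rightarrow> 'c" where
  "std_term num e (FVar x) = e x"
| "std_term num e (FObj c) = c"
| "std_term num e (FAbs t) = num \<bar>inv num (std_term num e t)\<bar>"
| "std_term num e (FBin FAdd a b) = num (inv num (std_term num e a) + inv num (std_term num e b))"
| "std_term num e (FBin FSub a b) = num (inv num (std_term num e a) - inv num (std_term num e b))"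
| "std_term num e (FBin FMul a b) = num (inv num (std_term num e a) * inv num (std_term num e b))"

fun crel_holds :: "crel \<Rightarrow> 'c::linorder \<Rightarrow> 'c \<Rightarrow> bool" where
  "crel_holds CNeq x y = (x \<noteq> y)"
| "crel_holds CLt x y = (x < y)"
| "crel_holds CGt x y = (x > y)"
| "crel_holds CLe x y = (x \<le> y)"
| "crel_holds CGe x y = (x \<ge> y)"

text \<open>classical satisfaction in the standard interpretation (general domain: all precomputed
  terms, integer domain: the numerals); only used for formulas without p/n, Atleast, etc.\<close>
fun std_sat :: "(int \<Rightarrow> 'c::linorder) \<Rightarrow> (fvar \<Rightarrow> 'c) \<Rightarrow> 'c fform \<Rightarrow> bool" where
  "std_sat num e FBot = False"
| "std_sat num e (FEq a b) = (std_term num e a = std_term num e b)"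
| "std_sat num e (FCmp r a b) = crel_holds r (std_term num e a) (std_term num e b)"
| "std_sat num e (FP p ts) = False"
| "std_sat num e (FAtleast X V F ts) = False"
| "std_sat num e (FAtmost X V F ts) = False"
| "std_sat num e (FStart X V F ts) = False"
| "std_sat num e (FAnd A B) = (std_sat num e A \<and> std_sat num e B)"
| "std_sat num e (FOr A B) = (std_sat num e A \<or> std_sat num e B)"
| "std_sat num e (FImp A B) = (std_sat num e A \<longrightarrow> std_sat num e B)"
| "std_sat num e (FAll x A) =
     (if is_ivar x then (\<forall>n. std_sat num (e(x := num n)) A) else (\<forall>c. std_sat num (e(x := c)) A))"
| "std_sat num e (FEx x A) =
     (if is_ivar x then (\<exists>n. std_sat num (e(x := num n)) A) else (\<exists>c. std_sat num (e(x := c)) A))"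

definition Std :: "(int \<Rightarrow> 'c::linorder) \<Rightarrow> 'c set \<Rightarrow> 'c fform set" where
  "Std num symc = {A. wff num symc A \<and> sig0 A \<and> no_pn A \<and> fv A = {}
      \<and> (\<forall>e. (\<forall>n. e (IV n) \<in> range num) \<longrightarrow> std_sat num e A)}"

definition zero :: "(int \<Rightarrow> 'c) \<Rightarrow> 'c fterm" where "zero num = FObj (num 0)"
definition one :: "(int \<Rightarrow> 'c) \<Rightarrow> 'c fterm" where "one num = FObj (num 1)"

definition lex_less :: "fvar list \<Rightarrow> fvar list \<Rightarrow> 'c fform" where
  "lex_less X U = FOrs (map (\<lambda>l. FAnd (FCmp CLt (FVar (X ! l)) (FVar (U ! l)))
       (FAnds (map (\<lambda>k. FEq (FVar (X ! k)) (FVar (U ! k))) [0..<l]))) [0..<length X])"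

definition pred_idx_ok :: "(int \<Rightarrow> 'c) \<Rightarrow> 'c set \<Rightarrow> fvar list \<Rightarrow> fvar list \<Rightarrow> 'c fform \<Rightarrow> bool" where
  "pred_idx_ok num symc X V F \<longleftrightarrow> distinct (X @ V) \<and> (\<forall>x\<in>set (X @ V). is_gvar x)
      \<and> sig0 F \<and> wff num symc F \<and> fv F \<subseteq> set X \<union> set V"

definition D0 :: "(int \<Rightarrow> 'c) \<Rightarrow> 'c set \<Rightarrow> 'c fform set" where
  "D0 num symc = (\<Union>X V F U N.
     if pred_idx_ok num symc X V F \<and> distinct U \<and> (\<forall>u\<in>set U. is_gvar u) \<and> length U = length X
        \<and> set U \<inter> (set X \<union> set V) = {} \<and> is_ivar N
     then {FAlls (X @ V @ [N]) (FImp (FCmp CLe (FVar N) (zero num))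
              (FStart X V F (map FVar X @ map FVar V @ [FVar N]))),
           FAlls (X @ V) (FIff (FStart X V F (map FVar X @ map FVar V @ [one num])) F),
           FAlls (X @ V @ [N]) (FImp (FCmp CGt (FVar N) (zero num))
              (FIff (FStart X V F (map FVar X @ map FVar V @ [FBin FAdd (FVar N) (one num)]))
                    (FAnd F (FExs U (FAnd (lex_less X U)
                        (FStart X V F (map FVar U @ map FVar V @ [FVar N])))))))}
     else {})"

definition D1 :: "(int \<Rightarrow> 'c) \<Rightarrow> 'c set \<Rightarrow> 'c fform set" where
  "D1 num symc = (\<Union>X V F Y N.
     if pred_idx_ok num symc X V F \<and> is_gvar Y \<and> Y \<notin> set X \<union> set V \<and> is_ivar N
     then {FAlls (V @ [Y]) (FIff (FAtleast X V F (map FVar V @ [FVar Y]))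
              (FExs (X @ [N]) (FAnd (FStart X V F (map FVar X @ map FVar V @ [FVar N]))
                                    (FCmp CGe (FVar N) (FVar Y))))),
           FAlls (V @ [Y]) (FIff (FAtmost X V F (map FVar V @ [FVar Y]))
              (FAlls (X @ [N]) (FImp (FStart X V F (map FVar X @ map FVar V @ [FVar N]))
                                     (FCmp CLe (FVar N) (FVar Y)))))}
     else {})"

definition Ind :: "(int \<Rightarrow> 'c) \<Rightarrow> 'c set \<Rightarrow> 'c fform set" where
  "Ind num symc = {G. \<exists>A N. wff num symc A \<and> is_ivar N \<and>
     is_ucl G (FImp (FAnd (subst N (zero num) A)
                          (FAll N (FImp (FAnd (FCmp CGe (FVar N) (zero num)) A)
                                        (subst N (FBin FAdd (FVar N) (one num)) A))))
                    (FAll N (FImp (FCmp CGe (FVar N) (zero num)) A)))}"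

definition HTax :: "(int \<Rightarrow> 'c) \<Rightarrow> 'c set \<Rightarrow> 'c fform set" where
  "HTax num symc =
     {FOr A (FOr (FImp A B) (FNeg B)) | A B. wff num symc A \<and> wff num symc B}
   \<union> {FEx x (FImp A (FAll x A)) | x A. wff num symc A}"

definition logic_axioms :: "(int \<Rightarrow> 'c) \<Rightarrow> 'c set \<Rightarrow> 'c fform set" where
  "logic_axioms num symc = {F. wff num symc F \<and> (
      (\<exists>A B. F = FImp A (FImp B A))
    \<or> (\<exists>A B C. F = FImp (FImp A (FImp B C)) (FImp (FImp A B) (FImp A C)))
    \<or> (\<exists>A B. F = FImp (FAnd A B) A)
    \<or> (\<exists>A B. F = FImp (FAnd A B) B)
    \<or> (\<exists>A B. F = FImp A (FImp B (FAnd A B)))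
    \<or> (\<exists>A B. F = FImp A (FOr A B))
    \<or> (\<exists>A B. F = FImp B (FOr A B))
    \<or> (\<exists>A B C. F = FImp (FImp A C) (FImp (FImp B C) (FImp (FOr A B) C)))
    \<or> (\<exists>A. F = FImp FBot A)
    \<or> (\<exists>x t A. sort_ok num x t \<and> free_for t x A \<and> F = FImp (FAll x A) (subst x t A))
    \<or> (\<exists>x t A. sort_ok num x t \<and> free_for t x A \<and> F = FImp (subst x t A) (FEx x A))
    \<or> (\<exists>x. F = FEq (FVar x) (FVar x))
    \<or> (\<exists>z s t A. sort_ok num z s \<and> sort_ok num z t \<and> free_for s z A \<and> free_for t z A
         \<and> F = FImp (FEq s t) (FImp (subst z s A) (subst z t A))))}"

definition ht_axioms :: "(int \<Rightarrow> 'c::linorder) \<Rightarrow> 'c set \<Rightarrow> 'c fform set" where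
  "ht_axioms num symc = logic_axioms num symc \<union> HTax num symc \<union> Std num symc
     \<union> Ind num symc \<union> D0 num symc \<union> D1 num symc"

inductive ht_prov :: "(int \<Rightarrow> 'c::linorder) \<Rightarrow> 'c set \<Rightarrow> 'c fform \<Rightarrow> bool" for num symc where
  ax: "A \<in> ht_axioms num symc \<Longrightarrow> ht_prov num symc A"
| mp: "ht_prov num symc (FImp A B) \<Longrightarrow> ht_prov num symc A \<Longrightarrow> ht_prov num symc B"
| gen_all: "ht_prov num symc (FImp B A) \<Longrightarrow> x \<notin> fv B \<Longrightarrow> ht_prov num symc (FImp B (FAll x A))"
| gen_ex: "ht_prov num symc (FImp A B) \<Longrightarrow> x \<notin> fv B \<Longrightarrow> ht_prov num symc (FImp (FEx x A) B)"

text \<open>Program variable v is the general variable GV (2v); fresh general variables are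
  GV (2k+1), fresh integer variables IV k, with k a counter threaded through the translation.\<close>
definition pv :: "nat \<Rightarrow> fvar" where "pv v = GV (2 * v)"
definition fg :: "nat \<Rightarrow> fvar" where "fg k = GV (2 * k + 1)"

definition fresh_gs :: "nat \<Rightarrow> nat \<Rightarrow> fvar list" where
  "fresh_gs k n = map (\<lambda>i. fg (k + i)) [0..<n]"

definition bin_val :: "(int \<Rightarrow> 'c) \<Rightarrow> binop \<Rightarrow> fvar \<Rightarrow> fvar \<Rightarrow> fvar \<Rightarrow> fvar
    \<Rightarrow> 'c fform \<Rightarrow> 'c fform \<Rightarrow> 'c fform" where
  "bin_val num op Z I J K A B = (let
     vZ = FVar Z; vI = FVar I; vJ = FVar J; vK = FVar K;
     kJ_le_I = FCmp CLe (FBin FMul vK (FAbs vJ)) (FAbs vI);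
     I_lt = FCmp CLt (FAbs vI) (FBin FMul (FBin FAdd vK (one num)) (FAbs vJ));
     pos = FCmp CGe (FBin FMul vI vJ) (zero num);
     neg = FCmp CLt (FBin FMul vI vJ) (zero num)
   in case op of
     BAdd \<Rightarrow> FExs [I, J] (FAnd A (FAnd B (FEq vZ (FBin FAdd vI vJ))))
   | BSub \<Rightarrow> FExs [I, J] (FAnd A (FAnd B (FEq vZ (FBin FSub vI vJ))))
   | BMul \<Rightarrow> FExs [I, J] (FAnd A (FAnd B (FEq vZ (FBin FMul vI vJ))))
   | BDiv \<Rightarrow> FExs [I, J, K] (FAnd A (FAnd B (FAnd (FAnd kJ_le_I I_lt)
        (FOr (FAnd pos (FEq vZ vK)) (FAnd neg (FEq vZ (FBin FSub (zero num) vK)))))))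
   | BMod \<Rightarrow> FExs [I, J, K] (FAnd A (FAnd B (FAnd (FAnd kJ_le_I I_lt)
        (FOr (FAnd pos (FEq vZ (FBin FSub vI (FBin FMul vK vJ))))
             (FAnd neg (FEq vZ (FBin FAdd vI (FBin FMul vK vJ))))))))
   | BDots \<Rightarrow> FExs [I, J, K] (FAnd A (FAnd B (FAnd (FAnd (FCmp CLe vI vK) (FCmp CLe vK vJ))
        (FEq vZ vK)))))"

fun valt :: "(int \<Rightarrow> 'c) \<Rightarrow> 'c pterm \<Rightarrow> fvar \<Rightarrow> nat \<Rightarrow> 'c fform \<times> nat" where
  "valt num (PT c) Z k = (FEq (FVar Z) (FObj c), k)"
| "valt num (PV v) Z k = (FEq (FVar Z) (FVar (pv v)), k)"
| "valt num (PAbs t) Z k = (case valt num t (IV k) (Suc k) of (A, k1) \<Rightarrow>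
     (FEx (IV k) (FAnd A (FEq (FVar Z) (FAbs (FVar (IV k))))), k1))"
| "valt num (PBin op a b) Z k = (case valt num a (IV k) (k + 3) of (A, k1) \<Rightarrow>
     (case valt num b (IV (k + 1)) k1 of (B, k2) \<Rightarrow>
       (bin_val num op Z (IV k) (IV (k + 1)) (IV (k + 2)) A B, k2)))"

fun valts :: "(int \<Rightarrow> 'c) \<Rightarrow> 'c pterm list \<Rightarrow> fvar list \<Rightarrow> nat \<Rightarrow> 'c fform list \<times> nat" where
  "valts num (t # ts) (Z # Zs) k = (case valt num t Z k of (A, k1) \<Rightarrow>
     (case valts num ts Zs k1 of (As, k2) \<Rightarrow> (A # As, k2)))"
| "valts num _ _ k = ([], k)"

fun tauB_lit :: "(int \<Rightarrow> 'c) \<Rightarrow> 'c plit \<Rightarrow> nat \<Rightarrow> 'c fform \<times> nat" where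
  "tauB_lit num l k = (case litatom l of PAtom p ts \<Rightarrow>
     (let Zs = fresh_gs k (length ts); P = FP p (map FVar Zs) in
      case valts num ts Zs (k + length ts) of (As, k1) \<Rightarrow>
        (FExs Zs (FAnd (FAnds As)
           (case l of Pos _ \<Rightarrow> P | Neg _ \<Rightarrow> FNeg P | NegNeg _ \<Rightarrow> FNeg (FNeg P))), k1)))"

fun rel_f :: "prel \<Rightarrow> 'c fterm \<Rightarrow> 'c fterm \<Rightarrow> 'c fform" where
  "rel_f REq a b = FEq a b"
| "rel_f RNeq a b = FCmp CNeq a b"
| "rel_f RLt a b = FCmp CLt a b"
| "rel_f RGt a b = FCmp CGt a b"
| "rel_f RLe a b = FCmp CLe a b"
| "rel_f RGe a b = FCmp CGe a b"

fun tauB_lc :: "(int \<Rightarrow> 'c) \<Rightarrow> 'c lc \<Rightarrow> nat \<Rightarrow> 'c fform \<times> nat" where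
  "tauB_lc num (LLit l) k = tauB_lit num l k"
| "tauB_lc num (LCmp r a b) k = (case valt num a (fg k) (k + 2) of (A, k1) \<Rightarrow>
     (case valt num b (fg (k + 1)) k1 of (B, k2) \<Rightarrow>
       (FExs [fg k, fg (k + 1)] (FAnd A (FAnd B (rel_f r (FVar (fg k)) (FVar (fg (k + 1)))))), k2)))"

fun tauB_lcs :: "(int \<Rightarrow> 'c) \<Rightarrow> 'c lc list \<Rightarrow> nat \<Rightarrow> 'c fform list \<times> nat" where
  "tauB_lcs num [] k = ([], k)"
| "tauB_lcs num (l # ls) k = (case tauB_lc num l k of (A, k1) \<Rightarrow>
     (case tauB_lcs num ls k1 of (As, k2) \<Rightarrow> (A # As, k2)))"

fun bstar :: "(int \<Rightarrow> 'c) \<Rightarrow> nat set \<Rightarrow> 'c belem \<Rightarrow> nat \<Rightarrow> 'c fform \<times> nat" where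
  "bstar num G (BL l) k = tauB_lc num l k"
| "bstar num G (BAgg X L op t) k = (
     let Vs = sorted_list_of_set (\<Union> (lcvars ` set L) \<inter> G);
         Ws = sorted_list_of_set (\<Union> (lcvars ` set L) - G - set X)
     in case tauB_lcs num L k of (Ls, k1) \<Rightarrow>
       (let F = FExs (map pv Ws) (FAnds Ls); C = fg k1;
            args = map FVar (map pv Vs) @ [FVar C];
            P = (case op of AGe \<Rightarrow> FAtleast (map pv X) (map pv Vs) F args
                          | ALe \<Rightarrow> FAtmost (map pv X) (map pv Vs) F args)
        in case valt num t C (Suc k1) of (A, k2) \<Rightarrow> (FEx C (FAnd A P), k2)))"

fun bstars :: "(int \<Rightarrow> 'c) \<Rightarrow> nat set \<Rightarrow> 'c belem list \<Rightarrow> nat \<Rightarrow> 'c fform list \<times> nat" where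
  "bstars num G [] k = ([], k)"
| "bstars num G (b # bs) k = (case bstar num G b k of (A, k1) \<Rightarrow>
     (case bstars num G bs k1 of (As, k2) \<Rightarrow> (A # As, k2)))"

fun head_star :: "(int \<Rightarrow> 'c) \<Rightarrow> bool \<Rightarrow> 'c patom \<Rightarrow> 'c fform list \<Rightarrow> nat \<Rightarrow> 'c fform" where
  "head_star num choice (PAtom p ts) Bs k = (
     let Zs = fresh_gs k (length ts); P = FP p (map FVar Zs) in
     case valts num ts Zs (k + length ts) of (As, k1) \<Rightarrow>
       FImp (FAnds (Bs @ [FAnds As])) (if choice then FOr P (FNeg P) else P))"

fun tau_star_rule :: "(int \<Rightarrow> 'c) \<Rightarrow> 'c rule \<Rightarrow> 'c fform" where
  "tau_star_rule num (Rule h B) = (case bstars num (globals (Rule h B)) B 0 of (Bs, k1) \<Rightarrow>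
     uclose (case h of
         HBasic a \<Rightarrow> head_star num False a Bs k1
       | HChoice a \<Rightarrow> head_star num True a Bs k1
       | HNone \<Rightarrow> FNeg (FAnds Bs)))"

definition tau_star :: "(int \<Rightarrow> 'c) \<Rightarrow> 'c rule set \<Rightarrow> 'c fform" where
  "tau_star num P = FAnds (map (tau_star_rule num) (SOME rs. set rs = P \<and> distinct rs))"

end

theory Submission
  imports Defs
begin

text \<open>A set of infinitary formulas is characterised up to strong equivalence by its here-and-there
  models. First-order formulas get an analogous two-world semantics over the standard domain, in
  which Start is interpreted by the existence of lexicographically increasing chains of tuples;
  persistence and the constant domain make all axioms of the deductive system valid. Since the
  lexicographic order is total, a chain of length n exists iff there is a set of n tuples, so the
  first-order translation of a program has the same here-and-there models as the propositional
  one, and provable equivalence transfers to the latter.\<close>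

section \<open>Here-and-there satisfaction of infinitary formulas\<close>

text \<open>Stability of \<open>I\<close> tests subsets of \<open>I\<close> against reducts taken at
  \<open>I\<close> only; this is why here-and-there equivalence survives any additional theory
  \<open>\<Phi>\<close>. On the first-order side only soundness for the standard two-world
  structures enters. Three points shape the semantics of counting. The bound of an aggregate can be
  any precomputed term, also one that is not a numeral, so a cardinality is compared with it as
  \<open>num n\<close> in the order of precomputed terms. \<open>Start\<close> holds for every
  nonpositive \<open>N\<close>; truncation by \<open>nat\<close> turns all of these into the chain
  of length 0, which matches the empty set of tuples. Finally, the axiom for \<open>Atmost\<close>
  has a quantified implication on its right side, which looks at both worlds; a here-chain is also a
  there-chain, so the there-chains decide. This agrees with tau, where an upper bound is a
  conjunction of negations, and a negation too is decided by the there-world.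
  \<open>Atleast\<close>, in contrast, counts in the here-world.\<close>

primrec iht :: "('a, 'i) iform \<Rightarrow> 'a set \<Rightarrow> 'a set \<Rightarrow> bool" where
  "iht IBot H T = False"
| "iht (IAtm a) H T = (a \<in> H)"
| "iht (IAnd S f) H T = (\<forall>i\<in>S. iht (f i) H T)"
| "iht (IOr S f) H T = (\<exists>i\<in>S. iht (f i) H T)"
| "iht (IImp F G) H T = ((iht F H T \<longrightarrow> iht G H T) \<and> (iht F T T \<longrightarrow> iht G T T))"

lemma iht_persistent: "iht F H T \<Longrightarrow> H \<subseteq> T \<Longrightarrow> iht F T T"
  by (induction F) auto

lemma iht_there_iff_isat: "iht F T T \<longleftrightarrow> isat T F"
  by (induction F) auto

text \<open>The reduct replaces a subformula false at \<open>T\<close> by bottom; by persistence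
  such a subformula is also false at the pair of worlds, so both evaluations agree clause by
  clause.\<close>

lemma isat_reduct_iff_iht: "H \<subseteq> T \<Longrightarrow> isat H (reduct T F) \<longleftrightarrow> iht F H T"
proof (induction F)
  case (IAnd S f)
  then show ?case
    by (auto simp: iht_there_iff_isat[symmetric] dest: iht_persistent)
next
  case (IOr S f)
  then show ?case
    by (auto simp: iht_there_iff_isat[symmetric] dest: iht_persistent)
qed (auto simp: iht_there_iff_isat)

text \<open>Both conditions in \<open>stable\<close> evaluate reducts at \<open>I\<close> in subsets
  of \<open>I\<close>, hence only pairs with \<open>H \<subseteq> T\<close> matter, and the members
  of \<open>\<Phi>\<close> contribute the same on both sides.\<close>

lemma stable_insert_cong:
  assumes "\<And>H T. H \<subseteq> T \<Longrightarrow> iht F H T \<longleftrightarrow> iht G H T"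
  shows "stable (insert F \<Phi>) I \<longleftrightarrow> stable (insert G \<Phi>) I"
proof -
  have "isat H (reduct I F) \<longleftrightarrow> isat H (reduct I G)" if "H \<subseteq> I" for H
    using assms that by (simp add: isat_reduct_iff_iht)
  then show ?thesis
    unfolding stable_def by blast
qed

lemma iht_bigand [simp]:
  assumes "inj_on e S"
  shows "iht (bigand e S f) H T \<longleftrightarrow> (\<forall>s\<in>S. iht (f s) H T)"
  using assms by (auto simp: bigand_def)

lemma iht_bigor [simp]:
  assumes "inj_on e S"
  shows "iht (bigor e S f) H T \<longleftrightarrow> (\<exists>s\<in>S. iht (f s) H T)"
  using assms by (auto simp: bigor_def)

lemma inj_on_ix [simp]:
  "inj_on IxRule A" "inj_on IxEnv B" "inj_on IxNat C" "inj_on IxTup D" "inj_on IxSet E"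
  "inj_on (\<lambda>r. IxTup [r]) K"
  by (auto simp: inj_on_def)

lemma iht_LAnd [simp]: "iht (LAnd Fs) H T \<longleftrightarrow> (\<forall>F\<in>set Fs. iht F H T)"
  by (auto simp: LAnd_def all_set_conv_all_nth)

lemma iht_LOr [simp]: "iht (LOr Fs) H T \<longleftrightarrow> (\<exists>F\<in>set Fs. iht F H T)"
  by (auto simp: LOr_def in_set_conv_nth Bex_def)

lemma iht_INeg [simp]: "iht (INeg F) H T \<longleftrightarrow> \<not> iht F H T \<and> \<not> iht F T T"
  by (simp add: INeg_def)

lemma iht_ITop [simp]: "iht ITop H T"
  by (simp add: ITop_def)

section \<open>Chains of tuples\<close>

text \<open>\<open>lex\<close> relates only lists of equal length, so the order is total on tuples
  of a fixed arity, and all members of a chain share their arity.\<close>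

definition tuple_less :: "'c::linorder list \<Rightarrow> 'c list \<Rightarrow> bool" where
  "tuple_less x u \<longleftrightarrow> (x, u) \<in> lex {(a, b). a < b}"

lemma tuple_less_length: "tuple_less x u \<Longrightarrow> length x = length u"
  by (simp add: tuple_less_def lexord_lex)

lemma tuple_less_irrefl: "\<not> tuple_less x x"
  by (simp add: tuple_less_def lexord_lex lexord_irreflexive)

lemma tuple_less_trans: "tuple_less x y \<Longrightarrow> tuple_less y z \<Longrightarrow> tuple_less x z"
  by (auto simp: tuple_less_def lexord_lex intro!: lexord_trans[of x y _ z] transI)

lemma tuple_less_total:
  "length x = length y \<Longrightarrow> x \<noteq> y \<Longrightarrow> tuple_less x y \<or> tuple_less y x"
  using lexord_linear[of "{(a, b). a < b}" x y]
  by (simp add: tuple_less_def lexord_lex) (metis neq_iff)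

lemma tuple_less_nth:
  assumes "length x = length u"
  shows "tuple_less x u \<longleftrightarrow> (\<exists>l<length x. x ! l < u ! l \<and> (\<forall>k<l. x ! k = u ! k))"
  using assms by (auto simp: tuple_less_def lexord_lex lexord_take_index_conv list_eq_iff_nth_eq)

text \<open>The intended meaning of \<open>Start\<close>: \<open>x\<close> is the least of
  \<open>n\<close> increasing tuples satisfying \<open>P\<close>. The clauses mirror the three
  schemes of \<open>D0\<close>; in particular length 0 is granted to every tuple, whether or not it
  satisfies \<open>P\<close>.\<close>

fun inc_chain :: "('c::linorder list \<Rightarrow> bool) \<Rightarrow> nat \<Rightarrow> 'c list \<Rightarrow> bool" where
  "inc_chain P 0 x = True"
| "inc_chain P (Suc 0) x = P x"
| "inc_chain P (Suc (Suc n)) x = (P x \<and> (\<exists>u. tuple_less x u \<and> inc_chain P (Suc n) u))"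

lemma inc_chain_mono:
  assumes "inc_chain P n x" "\<And>x. P x \<Longrightarrow> Q x"
  shows "inc_chain Q n x"
  using assms(1)
proof (induction n arbitrary: x)
  case (Suc n)
  then show ?case by (cases n) (auto intro: assms(2))
qed simp

text \<open>A chain from \<open>x\<close> never leaves the tuples of the length of \<open>x\<close>.
  This allows replacing an index formula by its propositional counterpart, an equivalence available
  only for tuples of the right arity.\<close>

lemma inc_chain_cong:
  assumes "\<And>y. length y = length x \<Longrightarrow> P y \<longleftrightarrow> Q y"
  shows "inc_chain P n x \<longleftrightarrow> inc_chain Q n x"
  using assms
proof (induction n arbitrary: x)
  case (Suc n)
  have "inc_chain P n u \<longleftrightarrow> inc_chain Q n u" if "tuple_less x u" for u
    using Suc.prems tuple_less_length[OF that] by (intro Suc.IH) simp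
  with Suc.prems show ?case by (cases n) auto
qed simp

text \<open>The induction carries along that \<open>x\<close> is the least member of the set; a
  smaller tuple put in front is then new, so the cardinality really grows.\<close>

lemma inc_chain_imp_set:
  assumes "inc_chain P (Suc n) x"
  shows "\<exists>\<Delta>. finite \<Delta> \<and> card \<Delta> = Suc n \<and> x \<in> \<Delta> \<and>
    (\<forall>y\<in>\<Delta>. P y \<and> (y = x \<or> tuple_less x y))"
  using assms
proof (induction n arbitrary: x)
  case 0
  then show ?case by (intro exI[of _ "{x}"]) auto
next
  case (Suc n)
  then obtain u where u: "P x" "tuple_less x u" "inc_chain P (Suc n) u" by auto
  from Suc.IH[OF u(3)] obtain \<Delta> where \<Delta>: "finite \<Delta>" "card \<Delta> = Suc n" "u \<in> \<Delta>"
    "\<forall>y\<in>\<Delta>. P y \<and> (y = u \<or> tuple_less u y)" by blast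
  have less: "tuple_less x y" if "y \<in> \<Delta>" for y
    using that u(2) \<Delta>(4) tuple_less_trans[OF u(2), of y] by auto
  then have "x \<notin> \<Delta>" using tuple_less_irrefl by blast
  with \<Delta> u less show ?case by (intro exI[of _ "insert x \<Delta>"]) auto
qed

text \<open>The fixed length makes the order total on the set. Its least member is removed, and it
  precedes the start of the chain found in the rest.\<close>

lemma set_imp_inc_chain:
  assumes "finite \<Delta>" "card \<Delta> = Suc n" "\<forall>y\<in>\<Delta>. length y = m \<and> P y"
  shows "\<exists>x\<in>\<Delta>. inc_chain P (Suc n) x"
  using assms
proof (induction n arbitrary: \<Delta>)
  case 0
  then show ?case by (auto simp: card_Suc_eq)
next
  case (Suc n)
  have "\<exists>x\<in>\<Delta>. \<forall>y\<in>\<Delta>. y \<noteq> x \<longrightarrow> tuple_less x y"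
  proof (rule Finite_Set.bex_least_element)
    show "transp_on \<Delta> tuple_less"
      by (rule transp_onI) (rule tuple_less_trans)
    show "totalp_on \<Delta> tuple_less"
      by (rule totalp_onI) (metis Suc.prems(3) tuple_less_total)
  qed (use Suc.prems in auto)
  then obtain x where x: "x \<in> \<Delta>" "\<forall>y\<in>\<Delta>. y \<noteq> x \<longrightarrow> tuple_less x y" by blast
  have "\<exists>u\<in>\<Delta> - {x}. inc_chain P (Suc n) u"
    using Suc.prems x(1) by (intro Suc.IH) auto
  then obtain u where "u \<in> \<Delta>" "u \<noteq> x" "inc_chain P (Suc n) u" by blast
  with x Suc.prems(3) show ?case by (intro bexI[of _ x]) auto
qed

lemma inc_chain_iff_set:
  "(\<exists>x. length x = m \<and> inc_chain P n x) \<longleftrightarrow>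
    (\<exists>\<Delta>\<in>tuple_sets m. card \<Delta> = n \<and> (\<forall>y\<in>\<Delta>. P y))"
proof (cases n)
  case 0
  have "{} \<in> tuple_sets m" by (simp add: tuple_sets_def)
  \<comment> \<open>For chain length 0 both sides are true: any tuple of length \<open>m\<close>
    serves on the left, the empty set on the right.\<close>
  moreover have "length (replicate m undefined) = m" by simp
  ultimately have "\<exists>x::'a list. length x = m" "\<exists>\<Delta>\<in>tuple_sets m. card \<Delta> = n \<and> (\<forall>y\<in>\<Delta>. P y)"
    using 0 by (blast, intro bexI[of _ "{}"]) auto
  then show ?thesis using 0 by simp
next
  case (Suc k)
  show ?thesis
  proof
    assume "\<exists>x. length x = m \<and> inc_chain P n x"
    then obtain x where "length x = m" "inc_chain P (Suc k) x" using Suc by auto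
    with inc_chain_imp_set[of P k x] obtain \<Delta>
      where "finite \<Delta>" "card \<Delta> = Suc k" "\<forall>y\<in>\<Delta>. P y \<and> length y = m"
      by (metis tuple_less_length)
    then show "\<exists>\<Delta>\<in>tuple_sets m. card \<Delta> = n \<and> (\<forall>y\<in>\<Delta>. P y)"
      unfolding tuple_sets_def Suc by blast
  next
    assume "\<exists>\<Delta>\<in>tuple_sets m. card \<Delta> = n \<and> (\<forall>y\<in>\<Delta>. P y)"
    then show "\<exists>x. length x = m \<and> inc_chain P n x"
      using set_imp_inc_chain[of _ k m P] unfolding tuple_sets_def Suc by blast
  qed
qed

section \<open>Here-and-there satisfaction of first-order formulas\<close>

definition upds :: "(fvar \<Rightarrow> 'c) \<Rightarrow> fvar list \<Rightarrow> 'c list \<Rightarrow> fvar \<Rightarrow> 'c" where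
  "upds e xs vs = (\<lambda>y. case map_of (zip xs vs) y of None \<Rightarrow> e y | Some v \<Rightarrow> v)"

text \<open>The predicate constants indexed by a formula get the meaning forced by the axioms D0 and
  D1; for Atmost, persistence makes it enough to look at the there-world.\<close>

primrec fsat :: "(int \<Rightarrow> 'c::linorder) \<Rightarrow> 'c fform \<Rightarrow> ('c \<times> 'c list) set \<Rightarrow> ('c \<times> 'c list) set
    \<Rightarrow> (fvar \<Rightarrow> 'c) \<Rightarrow> bool" where
  "fsat num FBot H T e = False"
| "fsat num (FEq a b) H T e = (std_term num e a = std_term num e b)"
| "fsat num (FCmp r a b) H T e = crel_holds r (std_term num e a) (std_term num e b)"
| "fsat num (FP p ts) H T e = ((p, map (std_term num e) ts) \<in> H)"
| "fsat num (FAtleast X V F ts) H T e = (\<exists>x n. length x = length X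
     \<and> inc_chain (\<lambda>x. fsat num F H T
          (upds (\<lambda>_. num 0) (X @ V) (x @ butlast (map (std_term num e) ts)))) (nat n) x
     \<and> last (map (std_term num e) ts) \<le> num n)"
| "fsat num (FAtmost X V F ts) H T e = (\<forall>x n. length x = length X
     \<and> inc_chain (\<lambda>x. fsat num F T T
          (upds (\<lambda>_. num 0) (X @ V) (x @ butlast (map (std_term num e) ts)))) (nat n) x
     \<longrightarrow> num n \<le> last (map (std_term num e) ts))"
| "fsat num (FStart X V F ts) H T e =
     inc_chain (\<lambda>x. fsat num F H T
          (upds (\<lambda>_. num 0) (X @ V) (x @ butlast (drop (length X) (map (std_term num e) ts)))))
       (nat (inv num (last (map (std_term num e) ts)))) (take (length X) (map (std_term num e) ts))"
| "fsat num (FAnd A B) H T e = (fsat num A H T e \<and> fsat num B H T e)"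
| "fsat num (FOr A B) H T e = (fsat num A H T e \<or> fsat num B H T e)"
| "fsat num (FImp A B) H T e = ((fsat num A H T e \<longrightarrow> fsat num B H T e)
     \<and> (fsat num A T T e \<longrightarrow> fsat num B T T e))"
| "fsat num (FAll x A) H T e =
     (\<forall>c. (is_ivar x \<longrightarrow> c \<in> range num) \<longrightarrow> fsat num A H T (e(x := c)))"
| "fsat num (FEx x A) H T e =
     (\<exists>c. (is_ivar x \<longrightarrow> c \<in> range num) \<and> fsat num A H T (e(x := c)))"

text \<open>\<open>fsat\<close> restricts bound integer variables to numerals; this is the same
  restriction for free ones.\<close>

definition proper :: "(int \<Rightarrow> 'c) \<Rightarrow> (fvar \<Rightarrow> 'c) \<Rightarrow> bool" where
  "proper num e \<longleftrightarrow> (\<forall>x. is_ivar x \<longrightarrow> e x \<in> range num)"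

lemma proper_upd: "proper num e \<Longrightarrow> (is_ivar x \<longrightarrow> c \<in> range num) \<Longrightarrow> proper num (e(x := c))"
  by (simp add: proper_def)

text \<open>Here-chains become there-chains by the induction hypothesis for the index formula; the
  clause for \<open>FAtmost\<close> does not look at \<open>H\<close> at all.\<close>

lemma fsat_persistent: "fsat num A H T e \<Longrightarrow> H \<subseteq> T \<Longrightarrow> fsat num A T T e"
proof (induction A arbitrary: e)
  case (FAtleast X V F ts)
  then show ?case by (auto intro: inc_chain_mono)
next
  case (FStart X V F ts)
  then show ?case by (auto elim!: inc_chain_mono)
qed auto

lemma std_term_cong: "(\<And>x. x \<in> tvars t \<Longrightarrow> e x = e' x) \<Longrightarrow> std_term num e t = std_term num e' t"
proof (induction t)
  case (FBin f a b)
  then show ?case by (cases f) auto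
qed auto

text \<open>Index formulas are harmless although \<open>fv\<close> ignores them: they are evaluated
  over the constant default \<open>num 0\<close>, updated by argument values, and never read
  \<open>e\<close> directly.\<close>

lemma fsat_cong: "(\<And>x. x \<in> fv A \<Longrightarrow> e x = e' x) \<Longrightarrow> fsat num A H T e = fsat num A H T e'"
proof (induction A arbitrary: H e e')
  case (FEq a b)
  then show ?case by (simp add: std_term_cong[of _ e e'])
next
  case (FCmp r a b)
  then show ?case by (simp add: std_term_cong[of _ e e'])
next
  case (FP p ts)
  have "map (std_term num e) ts = map (std_term num e') ts"
    using FP.prems by (auto intro!: std_term_cong)
  then show ?case by (simp del: map_eq_conv)
next
  case (FAtleast X V F ts)
  have "map (std_term num e) ts = map (std_term num e') ts"
    using FAtleast.prems by (auto intro!: std_term_cong)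
  then show ?case by (simp del: map_eq_conv)
next
  case (FAtmost X V F ts)
  have "map (std_term num e) ts = map (std_term num e') ts"
    using FAtmost.prems by (auto intro!: std_term_cong)
  then show ?case by (simp del: map_eq_conv)
next
  case (FStart X V F ts)
  have "map (std_term num e) ts = map (std_term num e') ts"
    using FStart.prems by (auto intro!: std_term_cong)
  then show ?case by (simp del: map_eq_conv)
next
  case (FImp A B)
  have "fsat num A H' T e = fsat num A H' T e'" "fsat num B H' T e = fsat num B H' T e'" for H'
    using FImp.prems by (intro FImp.IH; simp)+
  then show ?case by simp
next
  case (FAnd A B)
  have "fsat num A H T e = fsat num A H T e'" "fsat num B H T e = fsat num B H T e'"
    using FAnd.prems by (intro FAnd.IH; simp)+
  then show ?case by simp
next
  case (FOr A B)
  have "fsat num A H T e = fsat num A H T e'" "fsat num B H T e = fsat num B H T e'"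
    using FOr.prems by (intro FOr.IH; simp)+
  then show ?case by simp
next
  case (FAll y A)
  have "fsat num A H T (e(y := c)) = fsat num A H T (e'(y := c))" for c
    using FAll.prems by (intro FAll.IH) auto
  then show ?case by simp
next
  case (FEx y A)
  have "fsat num A H T (e(y := c)) = fsat num A H T (e'(y := c))" for c
    using FEx.prems by (intro FEx.IH) auto
  then show ?case by simp
qed auto

section \<open>Environments and quantifier prefixes\<close>

lemma upds_Nil [simp]: "upds e [] vs = e"
  by (simp add: upds_def)

text \<open>In \<open>upds\<close> the first binding of a variable wins, in iterated updates the
  last one; the freshness condition reconciles them.\<close>

lemma upds_Cons: "x \<notin> set xs \<Longrightarrow> upds e (x # xs) (c # vs) = upds (e(x := c)) xs vs"
  by (auto simp: upds_def fun_eq_iff split: option.splits dest: map_of_SomeD set_zip_leftD)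

lemma upds_notin [simp]: "y \<notin> set xs \<Longrightarrow> upds e xs vs y = e y"
  by (auto simp: upds_def split: option.splits dest: map_of_SomeD set_zip_leftD)

lemma upds_map [simp]: "y \<in> set xs \<Longrightarrow> upds e xs (map f xs) y = f y"
  by (simp add: upds_def map_of_zip_map)

lemma map_upds_same [simp]: "distinct xs \<Longrightarrow> length vs = length xs \<Longrightarrow> map (upds e xs vs) xs = vs"
  by (rule nth_equalityI) (simp_all add: upds_def map_of_zip_nth)

lemma map_upds_disjoint [simp]: "set xs \<inter> set ys = {} \<Longrightarrow> map (upds e ys vs) xs = map e xs"
  by (auto simp: disjoint_iff)

lemma proper_upds_gvars [intro]:
  assumes "proper num e" "\<forall>x\<in>set xs. is_gvar x"
  shows "proper num (upds e xs vs)"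
  unfolding proper_def
proof (intro allI impI)
  fix x assume "is_ivar x"
  then have "x \<notin> set xs" using assms(2) by (cases x) auto
  then show "upds e xs vs x \<in> range num" using assms(1) \<open>is_ivar x\<close> by (simp add: proper_def)
qed

lemma is_ivar_not_gvar: "is_ivar x \<longleftrightarrow> \<not> is_gvar x"
  by (cases x) auto

text \<open>When the arguments are the index variables themselves, the environment built for the
  index formula agrees with \<open>e\<close> on its free variables. \<open>D0\<close> uses
  \<open>F\<close> both as an index and as a formula, and this links the two roles.\<close>

lemma fsat_index:
  assumes "fv F \<subseteq> set X \<union> set V"
  shows "fsat num F H T (upds d (X @ V) (map e X @ map e V)) \<longleftrightarrow> fsat num F H T e"
  unfolding map_append[symmetric] using assms by (intro fsat_cong upds_map) auto

lemma fsat_FNeg [simp]: "fsat num (FNeg A) H T e \<longleftrightarrow> \<not> fsat num A H T e \<and> \<not> fsat num A T T e"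
  by (simp add: FNeg_def)

lemma fsat_FIff [simp]: "fsat num (FIff A B) H T e \<longleftrightarrow>
    (fsat num A H T e \<longleftrightarrow> fsat num B H T e) \<and> (fsat num A T T e \<longleftrightarrow> fsat num B T T e)"
  by (auto simp: FIff_def)

lemma fsat_FAnds [simp]: "fsat num (FAnds As) H T e \<longleftrightarrow> (\<forall>A\<in>set As. fsat num A H T e)"
  by (induction As rule: FAnds.induct) (auto simp: FTop_def)

lemma fsat_FOrs [simp]: "fsat num (FOrs As) H T e \<longleftrightarrow> (\<exists>A\<in>set As. fsat num A H T e)"
  by (induction As rule: FOrs.induct) auto

lemma fsat_FExs_gvars:
  "distinct xs \<Longrightarrow> \<forall>x\<in>set xs. is_gvar x \<Longrightarrow>
    fsat num (FExs xs A) H T e \<longleftrightarrow> (\<exists>vs. length vs = length xs \<and> fsat num A H T (upds e xs vs))"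
proof (induction xs arbitrary: e)
  case (Cons x xs)
  then show ?case
    by (auto simp: FExs_def length_Suc_conv is_ivar_not_gvar)
       (metis Cons.prems(1) distinct.simps(2) upds_Cons)+
qed (simp add: FExs_def)

lemma fsat_FAlls_gvars:
  "distinct xs \<Longrightarrow> \<forall>x\<in>set xs. is_gvar x \<Longrightarrow>
    fsat num (FAlls xs A) H T e \<longleftrightarrow> (\<forall>vs. length vs = length xs \<longrightarrow> fsat num A H T (upds e xs vs))"
proof (induction xs arbitrary: e)
  case (Cons x xs)
  then show ?case
    by (auto simp: FAlls_def length_Suc_conv is_ivar_not_gvar)
       (metis Cons.prems(1) distinct.simps(2) upds_Cons)+
qed (simp add: FAlls_def)

text \<open>Phrased with whole environments instead of value tuples so that prefixes of mixed sorts,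
  as in \<open>D0\<close> and in universal closures, are covered.\<close>

lemma fsat_FAlls:
  "proper num e \<Longrightarrow> fsat num (FAlls xs A) H T e \<longleftrightarrow>
    (\<forall>e'. proper num e' \<and> (\<forall>x. x \<notin> set xs \<longrightarrow> e' x = e x) \<longrightarrow> fsat num A H T e')"
proof (induction xs arbitrary: e)
  case Nil
  have "e' = e \<longleftrightarrow> (\<forall>x. e' x = e x)" for e' by auto
  with Nil show ?case by (auto simp: FAlls_def)
next
  case (Cons x xs)
  have "fsat num (FAlls (x # xs) A) H T e \<longleftrightarrow>
    (\<forall>c. (is_ivar x \<longrightarrow> c \<in> range num) \<longrightarrow> fsat num (FAlls xs A) H T (e(x := c)))"
    by (simp add: FAlls_def)
  also have "\<dots> \<longleftrightarrow> (\<forall>c. (is_ivar x \<longrightarrow> c \<in> range num) \<longrightarrow>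
      (\<forall>e'. proper num e' \<and> (\<forall>y. y \<notin> set xs \<longrightarrow> e' y = (e(x := c)) y) \<longrightarrow> fsat num A H T e'))"
    using Cons.IH[OF proper_upd[OF Cons.prems]] by blast
  also have "\<dots> \<longleftrightarrow>
      (\<forall>e'. proper num e' \<and> (\<forall>y. y \<notin> set (x # xs) \<longrightarrow> e' y = e y) \<longrightarrow> fsat num A H T e')"
    (is "?l \<longleftrightarrow> ?r")
  proof
    assume l: ?l
    show ?r
    proof (intro allI impI; elim conjE)
      fix e' assume e': "proper num e'" "\<forall>y. y \<notin> set (x # xs) \<longrightarrow> e' y = e y"
      then have "is_ivar x \<longrightarrow> e' x \<in> range num" by (simp add: proper_def)
      with l e' show "fsat num A H T e'" by auto
    qed
  next
    assume ?r
    then show ?l by auto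
  qed
  finally show ?case .
qed

lemma fsat_FAllsI:
  assumes "\<And>e. proper num e \<Longrightarrow> fsat num A H T e" "proper num e"
  shows "fsat num (FAlls xs A) H T e"
  using assms by (simp add: fsat_FAlls)

lemma finite_tvars: "finite (tvars t)"
  by (induction t) auto

lemma finite_fv: "finite (fv A)"
  by (induction A) (auto simp: finite_tvars)

lemma fsat_uclose:
  assumes "proper num e"
  shows "fsat num (uclose A) H T e \<longleftrightarrow> (\<forall>e. proper num e \<longrightarrow> fsat num A H T e)"
proof -
  obtain ys where "set ys = fv A" "distinct ys"
    using finite_distinct_list[OF finite_fv] by blast
  then have "is_ucl (uclose A) A"
    unfolding uclose_def by (intro someI[of "\<lambda>G. is_ucl G A" "FAlls ys A"]) (auto simp: is_ucl_def)
  then obtain xs where xs: "set xs = fv A" "uclose A = FAlls xs A"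
    by (auto simp: is_ucl_def)
  have "fsat num A H T e1"
    if all: "\<forall>e'. proper num e' \<and> (\<forall>x. x \<notin> set xs \<longrightarrow> e' x = e x) \<longrightarrow> fsat num A H T e'"
      and e1: "proper num e1" for e1
  proof -
    \<comment> \<open>The prefix reaches only environments equal to \<open>e\<close> outside the
      free variables, so \<open>e1\<close> is patched there; this does not change the truth of
      \<open>A\<close>.\<close>
    let ?e = "\<lambda>x. if x \<in> fv A then e1 x else e x"
    have "proper num ?e" using e1 assms by (simp add: proper_def)
    with all xs have "fsat num A H T ?e" by simp
    then show ?thesis by (subst (asm) fsat_cong[where e' = e1]) auto
  qed
  then show ?thesis
    unfolding xs(2) fsat_FAlls[OF assms] by blast
qed

section \<open>Soundness of the deductive system\<close>

lemma std_term_tsubst: "std_term num e (tsubst x s t) = std_term num (e(x := std_term num e s)) t"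
proof (induction t)
  case (FBin f a b)
  then show ?case by (cases f) auto
qed auto

lemma tsubst_fresh: "x \<notin> tvars t \<Longrightarrow> tsubst x s t = t"
  by (induction t) auto

lemma subst_fresh: "x \<notin> fv A \<Longrightarrow> subst x s A = A"
  by (induction A) (auto simp: tsubst_fresh intro!: map_idI)

text \<open>\<open>free_for\<close> tolerates a capturing binder when \<open>x\<close> is not free
  below it; then neither the substitution nor the update has any effect, which is the second case
  for the quantifiers.\<close>

lemma fsat_subst:
  "free_for s x A \<Longrightarrow> fsat num (subst x s A) H T e \<longleftrightarrow> fsat num A H T (e(x := std_term num e s))"
proof (induction A arbitrary: H e)
  case (FAll y A)
  consider "y = x" | "y \<noteq> x" "x \<notin> fv A" | "y \<noteq> x" "y \<notin> tvars s" "free_for s x A"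
    using FAll.prems by auto
  then show ?case
  proof cases
    case 2
    then have "fsat num A H T (e(x := d, y := c)) = fsat num A H T (e(y := c))" for c d
      by (intro fsat_cong) auto
    with 2 show ?thesis by (simp add: subst_fresh del: fun_upd_apply)
  next
    case 3
    then have "std_term num (e(y := c)) s = std_term num e s" for c
      by (intro std_term_cong) auto
    with 3 FAll.IH show ?thesis by (simp add: fun_upd_twist del: fun_upd_apply)
  qed (simp del: fun_upd_apply)
next
  case (FEx y A)
  consider "y = x" | "y \<noteq> x" "x \<notin> fv A" | "y \<noteq> x" "y \<notin> tvars s" "free_for s x A"
    using FEx.prems by auto
  then show ?case
  proof cases
    case 2
    then have "fsat num A H T (e(x := d, y := c)) = fsat num A H T (e(y := c))" for c d
      by (intro fsat_cong) auto
    with 2 show ?thesis by (simp add: subst_fresh del: fun_upd_apply)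
  next
    case 3
    then have "std_term num (e(y := c)) s = std_term num e s" for c
      by (intro std_term_cong) auto
    with 3 FEx.IH show ?thesis by (simp add: fun_upd_twist del: fun_upd_apply)
  qed (simp del: fun_upd_apply)
qed (auto simp: std_term_tsubst comp_def)

text \<open>A binder different from \<open>x\<close> has nothing to capture, and a binder of
  \<open>x\<close> stops the substitution. The induction axioms need this for zero and for
  \<open>N + 1\<close>.\<close>

lemma free_for_self: "tvars s \<subseteq> {x} \<Longrightarrow> free_for s x A"
  by (induction A) auto

lemma int_term_range: "proper num e \<Longrightarrow> int_term num t \<Longrightarrow> std_term num e t \<in> range num"
proof (induction t)
  case (FBin f a b)
  then show ?case by (cases f) auto
qed (auto simp: proper_def)

lemma sort_ok_range:
  "proper num e \<Longrightarrow> sort_ok num x t \<Longrightarrow> is_ivar x \<longrightarrow> std_term num e t \<in> range num"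
  by (simp add: sort_ok_def int_term_range)

text \<open>Comparisons and equality do not depend on the world, so both halves of an implication
  coincide and evaluation is classical.\<close>

lemma fsat_eq_std_sat:
  "sig0 A \<Longrightarrow> no_pn A \<Longrightarrow> fsat num A H T e \<longleftrightarrow> std_sat num e A"
  by (induction A arbitrary: H e) auto

lemma fsat_logic_axioms:
  assumes "A \<in> logic_axioms num symc" "proper num e" "H \<subseteq> T"
  shows "fsat num A H T e"
  using assms(1) unfolding logic_axioms_def mem_Collect_eq
proof (elim conjE disjE exE)
  fix x t B assume "sort_ok num x t" "free_for t x B" "A = FImp (FAll x B) (subst x t B)"
  then show ?thesis using sort_ok_range[OF assms(2)] by (simp add: fsat_subst)
next
  fix x t B assume "sort_ok num x t" "free_for t x B" "A = FImp (subst x t B) (FEx x B)"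
  then show ?thesis using sort_ok_range[OF assms(2), of x t]
    by (auto simp: fsat_subst intro!: exI[of _ "std_term num e t"] simp del: fun_upd_apply)
\<comment> \<open>Persistence is what validates axioms such as \<open>FImp A (FImp B A)\<close>,
  where the inner implication also inspects the there-world.\<close>
qed (use assms(3) fsat_persistent[of num _ H T e] in \<open>auto simp: fsat_subst\<close>)

lemma fsat_HTax:
  assumes "A \<in> HTax num symc" "H \<subseteq> T"
  shows "fsat num A H T e"
proof -
  have *: "fsat num (FEx x (FImp B (FAll x B))) H T e" for x B
  proof -
    let ?D = "\<lambda>c. is_ivar x \<longrightarrow> c \<in> range num"
    have pers: "fsat num B H T (e(x := c)) \<Longrightarrow> fsat num B T T (e(x := c))" for c
      using fsat_persistent assms(2) by blast
    \<comment> \<open>The witness refutes \<open>B\<close> at \<open>T\<close> if possible,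
      otherwise at \<open>H\<close>; if there is no counterexample, any value will do, and
      \<open>num 0\<close> belongs to both sorts. In the second case \<open>FAll x B\<close> holds
      at \<open>T\<close> because both worlds have the same domain.\<close>
    consider c where "?D c" "\<not> fsat num B T T (e(x := c))"
      | c where "?D c" "\<not> fsat num B H T (e(x := c))" "\<forall>c. ?D c \<longrightarrow> fsat num B T T (e(x := c))"
      | "\<forall>c. ?D c \<longrightarrow> fsat num B H T (e(x := c))"
      by blast
    then show ?thesis
    proof cases
      case 1
      with pers show ?thesis by (auto intro!: exI[of _ c])
    next
      case 2
      then show ?thesis by (auto intro!: exI[of _ c])
    next
      case 3
      with pers show ?thesis by (auto intro!: exI[of _ "num 0"])
    qed
  qed
  \<comment> \<open>If \<open>C\<close> fails at \<open>T\<close>, its negation holds. If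
    \<open>C\<close> holds at \<open>T\<close> and \<open>B\<close> fails at \<open>H\<close>, both
    halves of the implication hold.\<close>
  have "fsat num (FOr B (FOr (FImp B C) (FNeg C))) H T e" for B C
    using fsat_persistent[OF _ assms(2), of num B e] fsat_persistent[OF _ assms(2), of num C e] by auto
  with * assms(1) show ?thesis by (auto simp: HTax_def simp del: fsat.simps)
qed

lemma fsat_Std:
  assumes "A \<in> Std num symc" "proper num e"
  shows "fsat num A H T e"
  using assms by (simp add: Std_def fsat_eq_std_sat proper_def)

section \<open>Induction axioms and the axioms defining the counting predicates\<close>

lemma inv_num [simp]: "strict_mono num \<Longrightarrow> inv num (num (n :: int)) = n"
  by (simp add: inv_f_f strict_mono_imp_inj_on)

lemma fsat_Ind:
  assumes num: "strict_mono num" and A: "A \<in> Ind num symc" and e: "proper num e" and HT: "H \<subseteq> T"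
  shows "fsat num A H T e"
proof -
  obtain B N xs where N: "is_ivar N" and A: "A = FAlls xs (FImp (FAnd (subst N (zero num) B)
        (FAll N (FImp (FAnd (FCmp CGe (FVar N) (zero num)) B)
          (subst N (FBin FAdd (FVar N) (one num)) B))))
        (FAll N (FImp (FCmp CGe (FVar N) (zero num)) B)))"
    using A by (auto simp: Ind_def is_ucl_def)
  have "free_for (zero num) N B" "free_for (FBin FAdd (FVar N) (one num)) N B"
    by (auto intro!: free_for_self simp: zero_def one_def)
  note subst = this[THEN fsat_subst]
  \<comment> \<open>The world \<open>H'\<close> stays arbitrary because the outer implication has to
    be checked at \<open>H\<close> and again at \<open>T\<close>.\<close>
  have ind: "fsat num B H' T (e(N := num n))"
    if base: "fsat num (subst N (zero num) B) H' T e"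
      and step: "fsat num (FAll N (FImp (FAnd (FCmp CGe (FVar N) (zero num)) B)
          (subst N (FBin FAdd (FVar N) (one num)) B))) H' T e"
      and n: "n \<ge> 0" for H' e and n :: int
    using n
  proof (induction n rule: int_ge_induct)
    case base
    show ?case using that(1) unfolding subst(1) by (simp add: zero_def del: fun_upd_apply)
  next
    case (step i)
    then show ?case
      using that(2)[unfolded fsat.simps subst(2), rule_format, of "num i"] num
      by (simp add: zero_def one_def strict_mono_less_eq fun_upd_same del: fun_upd_apply)
  qed
  show ?thesis
    unfolding A
  proof (rule fsat_FAllsI[OF _ e])
    fix e
    have *: "fsat num (FAll N (FImp (FCmp CGe (FVar N) (zero num)) B)) H' T e"
      if "H' \<subseteq> T" "\<And>n. n \<ge> 0 \<Longrightarrow> fsat num B H' T (e(N := num n))" for H'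
      using that(2) fsat_persistent[OF _ that(1)] N num
      by (auto simp: zero_def strict_mono_less_eq)
    show "fsat num (FImp (FAnd (subst N (zero num) B)
        (FAll N (FImp (FAnd (FCmp CGe (FVar N) (zero num)) B)
          (subst N (FBin FAdd (FVar N) (one num)) B))))
        (FAll N (FImp (FCmp CGe (FVar N) (zero num)) B))) H T e"
      unfolding fsat.simps(8,10)[of num "subst N (zero num) B"] fsat.simps(10)
      using *[OF HT ind] *[OF order_refl ind] by blast
  qed
qed

lemma fsat_lex_less:
  assumes "length U = length X"
  shows "fsat num (lex_less X U) H T e \<longleftrightarrow> tuple_less (map e X) (map e U)"
  using assms by (auto simp: lex_less_def tuple_less_nth)

lemma fsat_FStart_vars:
  assumes "length Y = length X"
  shows "fsat num (FStart X V F (map FVar Y @ map FVar V @ [t])) H T e \<longleftrightarrow>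
    inc_chain (\<lambda>x. fsat num F H T (upds (\<lambda>_. num 0) (X @ V) (x @ map e V)))
      (nat (inv num (std_term num e t))) (map e Y)"
  using assms by (simp add: comp_def butlast_append)

lemma fsat_D0:
  assumes num: "strict_mono num" and A: "A \<in> D0 num symc" and e: "proper num e" and HT: "H \<subseteq> T"
  shows "fsat num A H T e"
proof -
  from A obtain X V F U N where idx: "pred_idx_ok num symc X V F"
    and U: "distinct U" "\<forall>u\<in>set U. is_gvar u" "length U = length X" "set U \<inter> (set X \<union> set V) = {}"
    and N: "is_ivar N" and
    cases: "A = FAlls (X @ V @ [N]) (FImp (FCmp CLe (FVar N) (zero num))
              (FStart X V F (map FVar X @ map FVar V @ [FVar N]))) \<or>
           A = FAlls (X @ V) (FIff (FStart X V F (map FVar X @ map FVar V @ [one num])) F) \<or>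
           A = FAlls (X @ V @ [N]) (FImp (FCmp CGt (FVar N) (zero num))
              (FIff (FStart X V F (map FVar X @ map FVar V @ [FBin FAdd (FVar N) (one num)]))
                    (FAnd F (FExs U (FAnd (lex_less X U)
                        (FStart X V F (map FVar U @ map FVar V @ [FVar N])))))))"
    unfolding D0_def by (auto split: if_splits simp del: FAlls_def)
  have F: "fv F \<subseteq> set X \<union> set V" using idx by (simp add: pred_idx_ok_def)
  have NU: "N \<notin> set U" using U(2) N by (auto simp: is_ivar_not_gvar)
  let ?P = "\<lambda>H' e x. fsat num F H' T (upds (\<lambda>_. num 0) (X @ V) (x @ map e V))"
  \<comment> \<open>Positivity of \<open>N\<close> makes \<open>nat n\<close> a successor, so
    \<open>n + 1\<close> falls under the clause of \<open>inc_chain\<close> that demands a larger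
    tuple.\<close>
  have rec: "fsat num (FStart X V F (map FVar X @ map FVar V @ [FBin FAdd (FVar N) (one num)])) H' T e
      \<longleftrightarrow> fsat num (FAnd F (FExs U (FAnd (lex_less X U)
                        (FStart X V F (map FVar U @ map FVar V @ [FVar N]))))) H' T e"
    if e: "proper num e" and pos: "num 0 < e N" for H' e
  proof -
    obtain n where n: "e N = num n" using e N by (auto simp: proper_def)
    with pos num have "n > 0" by (simp add: strict_mono_less)
    then obtain m where m: "nat n = Suc m" by (metis gr0_implies_Suc zero_less_nat_eq)
    with \<open>n > 0\<close> have m': "nat (n + 1) = Suc (Suc m)" by simp
    have "fsat num (FExs U (FAnd (lex_less X U)
            (FStart X V F (map FVar U @ map FVar V @ [FVar N])))) H' T e \<longleftrightarrow>
        (\<exists>u. length u = length U \<and> tuple_less (map e X) u \<and> inc_chain (?P H' e) (Suc m) u)"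
    proof -
      \<comment> \<open>Choosing values for \<open>U\<close> disturbs neither the current tuple nor
        the parameters, by disjointness from \<open>X\<close> and \<open>V\<close>.\<close>
      have "map (upds e U u) V = map e V" "map (upds e U u) X = map e X" for u
        using U(4) by (auto intro!: map_upds_disjoint simp del: map_eq_conv)
      then show ?thesis
        using U NU n m num
        by (simp add: fsat_FExs_gvars fsat_lex_less fsat_FStart_vars del: fsat.simps(7) map_eq_conv
            cong: conj_cong)
    qed
    also have "\<dots> \<longleftrightarrow> (\<exists>u. tuple_less (map e X) u \<and> inc_chain (?P H' e) (Suc m) u)"
      using U(3) by (metis length_map tuple_less_length)
    finally show ?thesis
      using n m' num
      by (simp add: fsat_FStart_vars one_def fsat_index[OF F] del: fsat.simps(7))
  qed
  show ?thesis
    using cases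
  proof (elim disjE)
    assume A: "A = FAlls (X @ V @ [N]) (FImp (FCmp CLe (FVar N) (zero num))
              (FStart X V F (map FVar X @ map FVar V @ [FVar N])))"
    show ?thesis
      unfolding A
    proof (rule fsat_FAllsI[OF _ e])
      fix e assume "proper num e"
      then obtain n where "e N = num n" using N by (auto simp: proper_def)
      then show "fsat num (FImp (FCmp CLe (FVar N) (zero num))
              (FStart X V F (map FVar X @ map FVar V @ [FVar N]))) H T e"
        using num by (simp add: fsat_FStart_vars zero_def strict_mono_less_eq del: fsat.simps(7))
    qed
  next
    assume A: "A = FAlls (X @ V) (FIff (FStart X V F (map FVar X @ map FVar V @ [one num])) F)"
    show ?thesis
      unfolding A
      by (rule fsat_FAllsI[OF _ e])
        (simp add: fsat_FStart_vars one_def num fsat_index[OF F] del: fsat.simps(7))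
  next
    assume A: "A = FAlls (X @ V @ [N]) (FImp (FCmp CGt (FVar N) (zero num))
              (FIff (FStart X V F (map FVar X @ map FVar V @ [FBin FAdd (FVar N) (one num)]))
                    (FAnd F (FExs U (FAnd (lex_less X U)
                        (FStart X V F (map FVar U @ map FVar V @ [FVar N])))))))"
    show ?thesis
      unfolding A
      by (rule fsat_FAllsI[OF _ e]) (simp add: rec zero_def del: fsat.simps(7,8))
  qed
qed

lemma fsat_FAtleast_vars:
  "fsat num (FAtleast X V F (map FVar V @ [t])) H T e \<longleftrightarrow>
    (\<exists>x n. length x = length X
      \<and> inc_chain (\<lambda>x. fsat num F H T (upds (\<lambda>_. num 0) (X @ V) (x @ map e V))) (nat n) x
      \<and> std_term num e t \<le> num n)"
  by (simp add: comp_def)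

lemma fsat_FAtmost_vars:
  "fsat num (FAtmost X V F (map FVar V @ [t])) H T e \<longleftrightarrow>
    (\<forall>x n. length x = length X
      \<and> inc_chain (\<lambda>x. fsat num F T T (upds (\<lambda>_. num 0) (X @ V) (x @ map e V))) (nat n) x
      \<longrightarrow> num n \<le> std_term num e t)"
  by (simp add: comp_def)

lemma fsat_D1:
  assumes num: "strict_mono num" and A: "A \<in> D1 num symc" and e: "proper num e" and HT: "H \<subseteq> T"
  shows "fsat num A H T e"
proof -
  from A obtain X V F Y N where idx: "pred_idx_ok num symc X V F"
    and Y: "is_gvar Y" "Y \<notin> set X \<union> set V" and N: "is_ivar N" and
    cases: "A = FAlls (V @ [Y]) (FIff (FAtleast X V F (map FVar V @ [FVar Y]))
              (FExs (X @ [N]) (FAnd (FStart X V F (map FVar X @ map FVar V @ [FVar N]))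
                                    (FCmp CGe (FVar N) (FVar Y))))) \<or>
           A = FAlls (V @ [Y]) (FIff (FAtmost X V F (map FVar V @ [FVar Y]))
              (FAlls (X @ [N]) (FImp (FStart X V F (map FVar X @ map FVar V @ [FVar N]))
                                     (FCmp CLe (FVar N) (FVar Y)))))"
    unfolding D1_def by (auto split: if_splits)
  have X: "distinct X" "\<forall>x\<in>set X. is_gvar x" "set V \<inter> set X = {}" "N \<notin> set X" "N \<notin> set V" "N \<noteq> Y"
    using idx N Y by (auto simp: pred_idx_ok_def is_ivar_not_gvar)
  let ?P = "\<lambda>H' e x. fsat num F H' T (upds (\<lambda>_. num 0) (X @ V) (x @ map e V))"
  have start: "fsat num (FStart X V F (map FVar X @ map FVar V @ [FVar N])) H' T ((upds e X x)(N := num n))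
      \<longleftrightarrow> inc_chain (?P H' e) (nat n) x" if "length x = length X" for H' e x n
  proof -
    have "map ((upds e X x)(N := num n)) V = map e V" "map ((upds e X x)(N := num n)) X = x"
      using X that map_upds_disjoint[OF X(3)] by (simp_all del: map_upds_disjoint)
    then show ?thesis using num by (simp add: fsat_FStart_vars del: fsat.simps(7) map_eq_conv)
  qed
  have ge: "fsat num (FExs (X @ [N]) (FAnd (FStart X V F (map FVar X @ map FVar V @ [FVar N]))
                                    (FCmp CGe (FVar N) (FVar Y)))) H' T e \<longleftrightarrow>
     fsat num (FAtleast X V F (map FVar V @ [FVar Y])) H' T e" for H' e
  proof -
    have "fsat num (FExs (X @ [N]) A) H' T e \<longleftrightarrow> fsat num (FExs X (FEx N A)) H' T e" for A
      by (simp add: FExs_def)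
    then show ?thesis
      using X N Y start
      by (auto simp: fsat_FExs_gvars fsat_FAtleast_vars simp del: fsat.simps(5,7))
  qed
  have le: "fsat num (FAlls (X @ [N]) (FImp (FStart X V F (map FVar X @ map FVar V @ [FVar N]))
                                    (FCmp CLe (FVar N) (FVar Y)))) H' T e \<longleftrightarrow>
     fsat num (FAtmost X V F (map FVar V @ [FVar Y])) H' T e" if "H' \<subseteq> T" for H' e
  proof -
    have "fsat num (FAlls (X @ [N]) A) H' T e \<longleftrightarrow> fsat num (FAlls X (FAll N A)) H' T e" for A
      by (simp add: FAlls_def)
    then have "fsat num (FAlls (X @ [N]) (FImp (FStart X V F (map FVar X @ map FVar V @ [FVar N]))
          (FCmp CLe (FVar N) (FVar Y)))) H' T e \<longleftrightarrow>
        (\<forall>x. length x = length X \<longrightarrow> (\<forall>n. (inc_chain (?P H' e) (nat n) x \<longrightarrow> num n \<le> e Y)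
          \<and> (inc_chain (?P T e) (nat n) x \<longrightarrow> num n \<le> e Y)))"
      using X N Y start by (auto simp: fsat_FAlls_gvars simp del: fsat.simps(7))
    \<comment> \<open>Every chain at \<open>H'\<close> is a chain at \<open>T\<close>, so the
      condition on chains at \<open>T\<close> subsumes the other one.\<close>
    also have "\<dots> \<longleftrightarrow>
        (\<forall>x n. length x = length X \<and> inc_chain (?P T e) (nat n) x \<longrightarrow> num n \<le> e Y)"
    proof -
      have "inc_chain (?P T e) n x" if "inc_chain (?P H' e) n x" for n x
        using that by (rule inc_chain_mono) (rule fsat_persistent[OF _ \<open>H' \<subseteq> T\<close>])
      then show ?thesis by blast
    qed
    finally show ?thesis by (simp only: fsat_FAtmost_vars std_term.simps)
  qed
  show ?thesis
    using cases
  proof (elim disjE)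
    assume A: "A = FAlls (V @ [Y]) (FIff (FAtleast X V F (map FVar V @ [FVar Y]))
              (FExs (X @ [N]) (FAnd (FStart X V F (map FVar X @ map FVar V @ [FVar N]))
                                    (FCmp CGe (FVar N) (FVar Y)))))"
    show ?thesis
      unfolding A by (rule fsat_FAllsI[OF _ e]) (simp add: ge del: fsat.simps)
  next
    assume A: "A = FAlls (V @ [Y]) (FIff (FAtmost X V F (map FVar V @ [FVar Y]))
              (FAlls (X @ [N]) (FImp (FStart X V F (map FVar X @ map FVar V @ [FVar N]))
                                     (FCmp CLe (FVar N) (FVar Y)))))"
    show ?thesis
      unfolding A by (rule fsat_FAllsI[OF _ e]) (simp add: le HT del: fsat.simps)
  qed
qed

text \<open>Each rule preserves truth at a pair of worlds; \<open>e\<close> is generalised because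
  the quantifier rules use their premise at updated environments.\<close>

theorem ht_prov_sound:
  assumes num: "strict_mono num" and "ht_prov num symc A" "proper num e" "H \<subseteq> T"
  shows "fsat num A H T e"
  using assms(2-)
proof (induction arbitrary: H e rule: ht_prov.induct)
  case (ax A)
  then show ?case
    unfolding ht_axioms_def
    by (auto intro: fsat_logic_axioms fsat_HTax fsat_Std fsat_Ind[OF num] fsat_D0[OF num]
        fsat_D1[OF num])
next
  case (mp A B)
  then show ?case by (meson fsat.simps(10))
next
  case (gen_all B A x)
  have B: "fsat num B H' T (e(x := c)) = fsat num B H' T e" for H' c
    using gen_all.hyps(2) by (intro fsat_cong) auto
  have "fsat num (FImp B A) H T (e(x := c))" if "is_ivar x \<longrightarrow> c \<in> range num" for c
    by (rule gen_all.IH[OF proper_upd[OF gen_all.prems(1) that] gen_all.prems(2)])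
  with B show ?case by simp
next
  case (gen_ex A B x)
  have B: "fsat num B H' T (e(x := c)) = fsat num B H' T e" for H' c
    using gen_ex.hyps(2) by (intro fsat_cong) auto
  have "fsat num (FImp A B) H T (e(x := c))" if "is_ivar x \<longrightarrow> c \<in> range num" for c
    by (rule gen_ex.IH[OF proper_upd[OF gen_ex.prems(1) that] gen_ex.prems(2)])
  with B show ?case by auto
qed

section \<open>Correctness of the translation\<close>

lemma pval_cong: "(\<And>v. v \<in> pvars t \<Longrightarrow> \<sigma> v = \<rho> v) \<Longrightarrow> pval num \<sigma> t = pval num \<rho> t"
proof (induction t)
  case (PBin op a b)
  then have "pval num \<sigma> a = pval num \<rho> a" "pval num \<sigma> b = pval num \<rho> b" by auto
  then show ?case by (simp only: pval.simps)
qed auto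

lemma pvals_cong:
  "(\<And>v. v \<in> \<Union> (pvars ` set ts) \<Longrightarrow> \<sigma> v = \<rho> v) \<Longrightarrow> pvals num \<sigma> ts = pvals num \<rho> ts"
  unfolding pvals_def by (intro arg_cong[of _ _ listset] map_cong pval_cong) auto

lemma tau_lc_cong: "(\<And>v. v \<in> lcvars l \<Longrightarrow> \<sigma> v = \<rho> v) \<Longrightarrow> tau_lc num \<sigma> l = tau_lc num \<rho> l"
proof (cases l)
  case (LLit q)
  assume *: "\<And>v. v \<in> lcvars l \<Longrightarrow> \<sigma> v = \<rho> v"
  obtain p ts where "litatom q = PAtom p ts" by (cases "litatom q")
  moreover from this * LLit have "pvals num \<sigma> ts = pvals num \<rho> ts" by (intro pvals_cong) auto
  ultimately show ?thesis using LLit by (cases q) auto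
next
  case (LCmp r a b)
  assume *: "\<And>v. v \<in> lcvars l \<Longrightarrow> \<sigma> v = \<rho> v"
  with LCmp have "pval num \<sigma> a = pval num \<rho> a" "pval num \<sigma> b = pval num \<rho> b"
    by (auto intro!: pval_cong)
  with LCmp show ?thesis by (simp only: tau_lc.simps)
qed

lemma finite_pvars: "finite (pvars t)"
  by (induction t) auto

lemma finite_lcvars: "finite (lcvars l)"
proof (cases l)
  case (LLit q)
  then show ?thesis by (cases "litatom q") (simp add: finite_pvars)
qed (simp add: finite_pvars)

lemma pvals_length: "r \<in> pvals num \<sigma> ts \<Longrightarrow> length r = length ts"
  unfolding pvals_def by (induction ts arbitrary: r) (auto simp: set_Cons_def)

text \<open>For \<open>j = 0\<close> the bounds would give \<open>\<bar>i\<bar> < 0\<close>; so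
  division by zero has no value in the formula, just as \<open>iop\<close> returns
  \<open>None\<close>. Otherwise they determine the quotient.\<close>

lemma div_iff_bounds:
  fixes i j k :: int
  shows "k * \<bar>j\<bar> \<le> \<bar>i\<bar> \<and> \<bar>i\<bar> < (k + 1) * \<bar>j\<bar> \<longleftrightarrow> j \<noteq> 0 \<and> k = \<bar>i\<bar> div \<bar>j\<bar>"
proof
  assume a: "k * \<bar>j\<bar> \<le> \<bar>i\<bar> \<and> \<bar>i\<bar> < (k + 1) * \<bar>j\<bar>"
  then have "j \<noteq> 0" by auto
  moreover from a have "\<bar>i\<bar> div \<bar>j\<bar> = k"
    by (intro int_div_pos_eq[of _ _ _ "\<bar>i\<bar> - k * \<bar>j\<bar>"]) (auto simp: algebra_simps)
  ultimately show "j \<noteq> 0 \<and> k = \<bar>i\<bar> div \<bar>j\<bar>" by simp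
next
  assume a: "j \<noteq> 0 \<and> k = \<bar>i\<bar> div \<bar>j\<bar>"
  then have "\<bar>i\<bar> = k * \<bar>j\<bar> + \<bar>i\<bar> mod \<bar>j\<bar>" "0 \<le> \<bar>i\<bar> mod \<bar>j\<bar>" "\<bar>i\<bar> mod \<bar>j\<bar> < \<bar>j\<bar>" by auto
  then show "k * \<bar>j\<bar> \<le> \<bar>i\<bar> \<and> \<bar>i\<bar> < (k + 1) * \<bar>j\<bar>" by (simp add: algebra_simps)
qed

section \<open>Formulas for the values of program terms\<close>

lemma pv_simps [simp]: "pv v \<noteq> IV k" "IV k \<noteq> pv v" "pv v \<noteq> fg k" "fg k \<noteq> pv v"
    "fg k \<noteq> IV j" "is_gvar (pv v)" "is_gvar (fg k)" "\<not> is_ivar (pv v)" "\<not> is_ivar (fg k)"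
    "pv v = pv w \<longleftrightarrow> v = w" "fg j = fg k \<longleftrightarrow> j = k"
  by (simp_all add: pv_def fg_def) presburger+

text \<open>Ensures that translating the second operand cannot reuse its own target
  \<open>IV (k + 1)\<close>, which was chosen before the counter advanced.\<close>

lemma valt_counter: "k \<le> snd (valt num t Z k)"
proof (induction t arbitrary: Z k)
  case (PAbs t)
  from this[of "Suc k" "IV k"] show ?case by (auto split: prod.split)
next
  case (PBin op a b)
  from PBin(1)[of "k + 3" "IV k"] PBin(2)[of "snd (valt num a (IV k) (k + 3))" "IV (k + 1)"]
  show ?case by (auto split: prod.split)
qed auto

text \<open>The operand hypotheses come in two forms because addition, subtraction and
  multiplication quantify over \<open>I\<close> and \<open>J\<close> only, the other operations also
  over \<open>K\<close>.\<close>

lemma fsat_bin_val: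
  assumes num: "strict_mono num"
    and IJK: "is_ivar I" "is_ivar J" "is_ivar K" "distinct [I, J, K]"
    and Z: "Z \<noteq> I" "Z \<noteq> J" "Z \<noteq> K"
    and A: "\<And>i j. fsat num A H T (e(I := num i, J := num j)) \<longleftrightarrow> num i \<in> pval num \<sigma> a"
      "\<And>i j l. fsat num A H T (e(I := num i, J := num j, K := num l))
        \<longleftrightarrow> num i \<in> pval num \<sigma> a"
    and B: "\<And>i j. fsat num B H T (e(I := num i, J := num j)) \<longleftrightarrow> num j \<in> pval num \<sigma> b"
      "\<And>i j l. fsat num B H T (e(I := num i, J := num j, K := num l))
        \<longleftrightarrow> num j \<in> pval num \<sigma> b"
  shows "fsat num (bin_val num op Z I J K A B) H T e
    \<longleftrightarrow> e Z \<in> pval num \<sigma> (PBin op a b)"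
proof -
  have two: "fsat num (FExs [I, J] C) H T e \<longleftrightarrow>
      (\<exists>i j. fsat num C H T (e(I := num i, J := num j)))" for C
    using IJK by (auto simp: FExs_def)
  have three: "fsat num (FExs [I, J, K] C) H T e \<longleftrightarrow>
      (\<exists>i j l. fsat num C H T (e(I := num i, J := num j, K := num l)))" for C
    using IJK by (auto simp: FExs_def)
  have pval_PBin: "e Z \<in> pval num \<sigma> (PBin op a b) \<longleftrightarrow> (\<exists>i j. num i \<in> pval num \<sigma> a \<and> num j \<in> pval num \<sigma> b \<and>
      (\<exists>r. iop op i j = Some r \<and> e Z = num r))" if "op \<noteq> BDots"
    using that by auto
  \<comment> \<open>A one-point rule: the bounds leave exactly one candidate for the third integer
    variable.\<close>
  have div: "(\<exists>l. (l * \<bar>j\<bar> \<le> \<bar>i\<bar> \<and> \<bar>i\<bar> < (l + 1) * \<bar>j\<bar>) \<and> Q l) \<longleftrightarrow> j \<noteq> 0 \<and> Q (\<bar>i\<bar> div \<bar>j\<bar>)"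
    for i j :: int and Q
    unfolding div_iff_bounds by auto
  show ?thesis
  proof (cases op)
    case BDiv
    have "fsat num (bin_val num op Z I J K A B) H T e \<longleftrightarrow>
      (\<exists>i j. num i \<in> pval num \<sigma> a \<and> num j \<in> pval num \<sigma> b \<and>
        (\<exists>l. (l * \<bar>j\<bar> \<le> \<bar>i\<bar> \<and> \<bar>i\<bar> < (l + 1) * \<bar>j\<bar>) \<and>
          (i * j \<ge> 0 \<and> e Z = num l \<or> i * j < 0 \<and> e Z = num (0 - l))))"
      using BDiv A B Z IJK num unfolding bin_val_def Let_def
      by (simp add: three zero_def one_def strict_mono_less_eq strict_mono_less)
    moreover have "j \<noteq> 0 \<and> (i * j \<ge> 0 \<and> e Z = num (\<bar>i\<bar> div \<bar>j\<bar>) \<or> i * j < 0 \<and> e Z = num (0 - (\<bar>i\<bar> div \<bar>j\<bar>))) \<longleftrightarrow>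
        (\<exists>r. iop op i j = Some r \<and> e Z = num r)" for i j
      using BDiv by (cases "i * j \<ge> 0") auto
    moreover have "op \<noteq> BDots" using BDiv by simp
    ultimately show ?thesis by (simp only: div pval_PBin not_False_eq_True)
  next
    case BMod
    have "fsat num (bin_val num op Z I J K A B) H T e \<longleftrightarrow>
      (\<exists>i j. num i \<in> pval num \<sigma> a \<and> num j \<in> pval num \<sigma> b \<and>
        (\<exists>l. (l * \<bar>j\<bar> \<le> \<bar>i\<bar> \<and> \<bar>i\<bar> < (l + 1) * \<bar>j\<bar>) \<and>
          (i * j \<ge> 0 \<and> e Z = num (i - l * j) \<or> i * j < 0 \<and> e Z = num (i + l * j))))"
      using BMod A B Z IJK num unfolding bin_val_def Let_def
      by (simp add: three zero_def one_def strict_mono_less_eq strict_mono_less)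
    moreover have "j \<noteq> 0 \<and> (i * j \<ge> 0 \<and> e Z = num (i - (\<bar>i\<bar> div \<bar>j\<bar>) * j) \<or> i * j < 0 \<and> e Z = num (i + (\<bar>i\<bar> div \<bar>j\<bar>) * j)) \<longleftrightarrow>
        (\<exists>r. iop op i j = Some r \<and> e Z = num r)" for i j
      using BMod by (cases "i * j \<ge> 0") auto
    moreover have "op \<noteq> BDots" using BMod by simp
    ultimately show ?thesis by (simp only: div pval_PBin not_False_eq_True)
  next
    case BDots
    then show ?thesis using A B Z IJK num unfolding bin_val_def Let_def
      by (simp add: three strict_mono_less_eq) blast
  qed (use A B Z IJK num in \<open>simp add: bin_val_def two; blast\<close>)+
qed

text \<open>The condition on \<open>Z\<close> is needed for operands, whose target is an integer
  variable: no quantifier introduced from counter \<open>k\<close> on may bind it.\<close>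

lemma fsat_valt:
  assumes num: "strict_mono num"
  shows "proper num e \<Longrightarrow> Z \<notin> {IV j | j. k \<le> j} \<Longrightarrow>
    fsat num (fst (valt num t Z k)) H T e \<longleftrightarrow> e Z \<in> pval num (\<lambda>v. e (pv v)) t"
proof (induction t arbitrary: Z k e)
  case (PAbs t)
  obtain A k1 where A: "valt num t (IV k) (Suc k) = (A, k1)" by force
  have "fsat num A H T (e(IV k := num i)) \<longleftrightarrow> num i \<in> pval num (\<lambda>v. e (pv v)) t" for i
    using PAbs.IH[OF proper_upd[OF PAbs.prems(1)], of "IV k" "num i" "IV k" "Suc k"] A
    by (simp add: fun_upd_def)
  moreover have "Z \<noteq> IV k" using PAbs.prems(2) by auto
  ultimately show ?case using A num by (auto simp: fun_upd_def)
next
  case (PBin op a b)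
  obtain A k1 where A: "valt num a (IV k) (k + 3) = (A, k1)" by force
  obtain B k2 where B: "valt num b (IV (k + 1)) k1 = (B, k2)" by force
  have k1: "k + 3 \<le> k1" using valt_counter[of "k + 3" num a "IV k"] A by simp
  have "fsat num A H T e' \<longleftrightarrow> e' (IV k) \<in> pval num (\<lambda>v. e' (pv v)) a" if "proper num e'" for e'
    using PBin.IH(1)[OF that, of "IV k" "k + 3"] A by simp
  moreover have "fsat num B H T e' \<longleftrightarrow> e' (IV (k + 1)) \<in> pval num (\<lambda>v. e' (pv v)) b"
    if "proper num e'" for e'
    using PBin.IH(2)[OF that, of "IV (k + 1)" k1] B k1 by simp
  ultimately have "fsat num (bin_val num op Z (IV k) (IV (k + 1)) (IV (k + 2)) A B) H T e
    \<longleftrightarrow> e Z \<in> pval num (\<lambda>v. e (pv v)) (PBin op a b)"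
    using PBin.prems by (intro fsat_bin_val num) (auto simp: proper_upd)
  then show ?case by (simp only: valt.simps A B prod.case fst_conv)
qed auto

lemma fsat_valts:
  shows "strict_mono num \<Longrightarrow> proper num e \<Longrightarrow> length Zs = length ts \<Longrightarrow> \<forall>Z\<in>set Zs. is_gvar Z \<Longrightarrow>
    (\<forall>A\<in>set (fst (valts num ts Zs k)). fsat num A H T e) \<longleftrightarrow>
      map e Zs \<in> pvals num (\<lambda>v. e (pv v)) ts"
proof (induction num ts Zs k rule: valts.induct)
  case (1 num t ts Z Zs k)
  obtain A k1 where A: "valt num t Z k = (A, k1)" by force
  obtain As k2 where As: "valts num ts Zs k1 = (As, k2)" by force
  have "fsat num A H T e \<longleftrightarrow> e Z \<in> pval num (\<lambda>v. e (pv v)) t"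
    using fsat_valt[OF 1(2,3), of Z k t H T] 1(5) A by (cases Z) auto
  with 1 A As show ?case by (simp add: pvals_def set_Cons_def)
qed (auto simp: pvals_def)

section \<open>Literals and comparisons\<close>

lemma fresh_gs_simps [simp]:
  "length (fresh_gs k n) = n" "distinct (fresh_gs k n)" "Z \<in> set (fresh_gs k n) \<Longrightarrow> is_gvar Z"
  "pv v \<notin> set (fresh_gs k n)"
  by (auto simp: fresh_gs_def distinct_map inj_on_def)

text \<open>The value formulas do not depend on the worlds, so the quantifier over \<open>Zs\<close>
  is the disjunction over \<open>pvals\<close>, and only the literal itself is evaluated at
  \<open>H\<close> and \<open>T\<close>.\<close>

lemma fsat_tauB_lit:
  fixes l :: "'c::linorder plit"
  assumes num: "strict_mono num" and e: "proper num e"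
  shows "fsat num (fst (tauB_lit num l k)) H T e \<longleftrightarrow>
    iht (tau_lit num (\<lambda>v. e (pv v)) l :: ('c, 'x) inf) H T"
proof -
  obtain p ts where l: "litatom l = PAtom p ts" by (cases "litatom l")
  let ?Zs = "fresh_gs k (length ts)" and ?\<sigma> = "\<lambda>v. e (pv v)"
  obtain As k1 where As: "valts num ts ?Zs (k + length ts) = (As, k1)" by force
  have *: "(\<forall>A\<in>set As. fsat num A H T (upds e ?Zs r)) \<longleftrightarrow> r \<in> pvals num ?\<sigma> ts"
    if "length r = length ts" for r
    using fsat_valts[OF num, of "upds e ?Zs r" ?Zs ts "k + length ts" H T] e As that
    by (simp add: proper_upds_gvars)
  have ex: "fsat num (FExs ?Zs (FAnd (FAnds As) P)) H T e \<longleftrightarrow>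
      (\<exists>r\<in>pvals num ?\<sigma> ts. fsat num P H T (upds e ?Zs r))" for P
    using * pvals_length[of _ num ?\<sigma> ts] by (auto simp: fsat_FExs_gvars)
  have FP: "fsat num (FP p (map FVar ?Zs)) H' T (upds e ?Zs r) \<longleftrightarrow> (p, r) \<in> H'"
    if "r \<in> pvals num ?\<sigma> ts" for H' r
    using pvals_length[OF that] by (simp add: comp_def)
  show ?thesis
    using l by (cases l) (auto simp: Let_def As ex FP simp del: fsat.simps(4))
qed

lemma fsat_tauB_lc:
  fixes l :: "'c::linorder lc"
  assumes num: "strict_mono num" and e: "proper num e"
  shows "fsat num (fst (tauB_lc num l k)) H T e \<longleftrightarrow>
    iht (tau_lc num (\<lambda>v. e (pv v)) l :: ('c, 'x) inf) H T"
proof (cases l)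
  case (LLit q)
  then show ?thesis using fsat_tauB_lit[OF assms] by (simp del: tauB_lit.simps)
next
  case (LCmp r a b)
  obtain A k1 where A: "valt num a (fg k) (k + 2) = (A, k1)" by force
  obtain B k2 where B: "valt num b (fg (k + 1)) k1 = (B, k2)" by force
  have "fsat num A H T (e(fg k := x, fg (k + 1) := y)) \<longleftrightarrow> x \<in> pval num (\<lambda>v. e (pv v)) a"
    "fsat num B H T (e(fg k := x, fg (k + 1) := y)) \<longleftrightarrow> y \<in> pval num (\<lambda>v. e (pv v)) b" for x y
    using fsat_valt[OF num, of "e(fg k := x, fg (k + 1) := y)" "fg k" "k + 2" a H T]
      fsat_valt[OF num, of "e(fg k := x, fg (k + 1) := y)" "fg (k + 1)" k1 b H T] A B e
    by (simp_all add: proper_upd)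
  moreover have "fsat num (rel_f r (FVar (fg k)) (FVar (fg (k + 1)))) H T
      (e(fg k := x, fg (k + 1) := y)) \<longleftrightarrow> rel_holds r x y" for x y
    by (cases r) simp_all
  ultimately show ?thesis
    using LCmp A B by (auto simp: FExs_def)
qed

lemma fsat_tauB_lcs:
  fixes L :: "'c::linorder lc list"
  assumes num: "strict_mono num" and e: "proper num e"
  shows "(\<forall>A\<in>set (fst (tauB_lcs num L k)). fsat num A H T e) \<longleftrightarrow>
    (\<forall>l\<in>set L. iht (tau_lc num (\<lambda>v. e (pv v)) l :: ('c, 'x) inf) H T)"
proof (induction L arbitrary: k)
  case (Cons l L)
  obtain A k1 where A: "tauB_lc num l k = (A, k1)" by force
  obtain As k2 where As: "tauB_lcs num L k1 = (As, k2)" by force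
  show ?case
    using Cons[of k1] fsat_tauB_lc[OF assms, of l k H T, where 'x = 'x] A As by simp
qed simp

section \<open>Aggregates\<close>

lemma map_upds_append:
  assumes "distinct (xs @ ys)" "length vs = length xs" "length us = length ys"
  shows "map (upds e (xs @ ys) (vs @ us)) xs = vs" "map (upds e (xs @ ys) (vs @ us)) ys = us"
proof -
  have "map (upds e (xs @ ys) (vs @ us)) (xs @ ys) = vs @ us"
    using assms by (intro map_upds_same) auto
  then show "map (upds e (xs @ ys) (vs @ us)) xs = vs" "map (upds e (xs @ ys) (vs @ us)) ys = us"
    using assms(2) by (auto simp del: map_eq_conv)
qed

text \<open>Matches the index formula of a counting predicate with its counterpart in tau. One side
  quantifies over values for \<open>Ws\<close>, the other over whole assignments that agree with the
  globals; they meet because \<open>L\<close> depends only on its own variables, which split into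
  \<open>X\<close>, \<open>Vs\<close> and \<open>Ws\<close>.\<close>

lemma fsat_agg_element:
  fixes L :: "'c::linorder lc list" and G :: "nat set" and X :: "nat list"
  defines "Vs \<equiv> sorted_list_of_set (\<Union> (lcvars ` set L) \<inter> G)"
    and "Ws \<equiv> sorted_list_of_set (\<Union> (lcvars ` set L) - G - set X)"
  assumes num: "strict_mono num" and X: "distinct X" "set X \<inter> G = {}" and x: "length x = length X"
  shows "fsat num (FExs (map pv Ws) (FAnds (fst (tauB_lcs num L k)))) H T
      (upds (\<lambda>_. num 0) (map pv X @ map pv Vs) (x @ map e (map pv Vs))) \<longleftrightarrow>
    iht (aggG num G (\<lambda>v. e (pv v)) X L x :: ('c, 'x) inf) H T"
proof -
  let ?d = "\<lambda>_. num 0" and ?\<sigma> = "\<lambda>v. e (pv v)" and ?C = "\<Union> (lcvars ` set L)"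
  let ?env = "upds ?d (map pv X @ map pv Vs) (x @ map e (map pv Vs))"
  have Vs: "set Vs = ?C \<inter> G" "distinct Vs" and Ws: "set Ws = ?C - G - set X" "distinct Ws"
    by (simp_all add: Vs_def Ws_def finite_lcvars)
  have dist: "distinct (map pv X @ map pv Vs)" "distinct (map pv Ws)"
    using X Vs Ws by (auto simp: distinct_map inj_on_def)
  have proper: "proper num ?env"
    by (intro proper_upds_gvars) (auto simp: proper_def)
  have env_X: "map (\<lambda>v. ?env (pv v)) X = x" and env_Vs: "\<forall>v\<in>set Vs. ?env (pv v) = ?\<sigma> v"
    using map_upds_append[OF dist(1), of x "map e (map pv Vs)" ?d] x by (simp_all add: comp_def)
  have L: "(\<forall>l\<in>set L. iht (tau_lc num \<rho> l :: ('c, 'x) inf) H T) \<longleftrightarrow>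
      (\<forall>l\<in>set L. iht (tau_lc num \<rho>' l :: ('c, 'x) inf) H T)" if "\<forall>v\<in>?C. \<rho> v = \<rho>' v" for \<rho> \<rho>'
    using that by (auto simp: tau_lc_cong[of _ \<rho> \<rho>'])
  let ?env' = "\<lambda>ws. upds ?env (map pv Ws) ws"
  have "fsat num (FExs (map pv Ws) (FAnds (fst (tauB_lcs num L k)))) H T ?env \<longleftrightarrow>
    (\<exists>ws. length ws = length Ws \<and>
      (\<forall>l\<in>set L. iht (tau_lc num (\<lambda>v. ?env' ws (pv v)) l :: ('c, 'x) inf) H T))"
    using dist(2) fsat_tauB_lcs[OF num, of "?env' ws" L k H T for ws, where 'x = 'x] proper
    by (simp add: fsat_FExs_gvars proper_upds_gvars)
  also have "\<dots> \<longleftrightarrow> (\<exists>\<rho>. (\<forall>v\<in>G. \<rho> v = ?\<sigma> v) \<and> map \<rho> X = x \<and>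
      (\<forall>l\<in>set L. iht (tau_lc num \<rho> l :: ('c, 'x) inf) H T))" (is "?l \<longleftrightarrow> ?r")
  proof
    assume ?l
    then obtain ws where ws: "length ws = length Ws"
      "\<forall>l\<in>set L. iht (tau_lc num (\<lambda>v. ?env' ws (pv v)) l :: ('c, 'x) inf) H T" by blast
    \<comment> \<open>Outside \<open>X\<close> and \<open>Ws\<close> the assignment follows the
      outer one: a global that does not occur in \<open>L\<close> is missing from \<open>Vs\<close>,
      and there the environment has only the default \<open>num 0\<close>. Disjointness of
      \<open>X\<close> from \<open>G\<close> makes the two rules compatible.\<close>
    define \<rho> where "\<rho> v = (if v \<in> set X \<union> set Ws then ?env' ws (pv v) else ?\<sigma> v)" for v
    have "pv v \<notin> set (map pv Ws)" if "v \<in> set X \<union> set Vs" for v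
      using that Ws Vs by auto
    then have env': "?env' ws (pv v) = ?env (pv v)" if "v \<in> set X \<union> set Vs" for v
      using that by simp
    have "map \<rho> X = map (\<lambda>v. ?env (pv v)) X"
      by (intro map_cong refl) (simp only: \<rho>_def env' Un_iff simp_thms if_True)
    then have "map \<rho> X = x" unfolding env_X .
    moreover have "\<forall>v\<in>G. \<rho> v = ?\<sigma> v" using X(2) Ws(1) by (auto simp: \<rho>_def)
    moreover have "\<forall>l\<in>set L. iht (tau_lc num \<rho> l :: ('c, 'x) inf) H T"
    proof (subst L)
      show "\<forall>v\<in>?C. \<rho> v = ?env' ws (pv v)"
      using Vs(1) Ws(1) env' env_Vs unfolding \<rho>_def by (metis DiffI IntI UnCI)
    qed (rule ws(2))
    ultimately show ?r by blast
  next
    assume ?r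
    then obtain \<rho> where \<rho>: "\<forall>v\<in>G. \<rho> v = ?\<sigma> v" "map \<rho> X = x"
      "\<forall>l\<in>set L. iht (tau_lc num \<rho> l :: ('c, 'x) inf) H T" by blast
    let ?ws = "map \<rho> Ws"
    have "map (?env' ?ws) (map pv Ws) = ?ws" using dist(2) by (intro map_upds_same) auto
    then have "\<forall>v\<in>set Ws. ?env' ?ws (pv v) = \<rho> v" by simp
    moreover have "?env' ?ws (pv v) = \<rho> v" if "v \<in> set X \<union> set Vs" for v
    proof -
      have "pv v \<notin> set (map pv Ws)" using that Ws Vs by auto
      then have "?env' ?ws (pv v) = ?env (pv v)" by simp
      also have "\<dots> = \<rho> v"
      proof (cases "v \<in> set X")
        case True
        have "map (\<lambda>v. ?env (pv v)) X = map \<rho> X" using env_X \<rho>(2) by simp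
        with True show ?thesis by (simp only: map_eq_conv)
      next
        case False
        then show ?thesis using that env_Vs \<rho>(1) Vs(1) by auto
      qed
      finally show ?thesis .
    qed
    ultimately have "\<forall>v\<in>?C. ?env' ?ws (pv v) = \<rho> v"
      using Vs(1) Ws(1) by blast
    then have "\<forall>l\<in>set L. iht (tau_lc num (\<lambda>v. ?env' ?ws (pv v)) l :: ('c, 'x) inf) H T"
      using \<rho>(3) by (subst L)
    then show ?l by (intro exI[of _ ?ws] conjI length_map)
  qed
  finally show ?thesis
    by (simp add: aggG_def)
qed

text \<open>Only the bound \<open>c\<close> is an arbitrary precomputed term; the lengths are
  integers, and the tuples of a chain form a set of that cardinality.\<close>

lemma at_least_iff_set:
  assumes "strict_mono num"
  shows "(\<exists>x n. length x = m \<and> inc_chain P (nat n) x \<and> c \<le> num n) \<longleftrightarrow>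
    (\<exists>\<Delta>\<in>tuple_sets m. c \<le> num (int (card \<Delta>)) \<and> (\<forall>y\<in>\<Delta>. P y))" (is "?l \<longleftrightarrow> ?r")
proof
  assume ?l
  then obtain x n where x: "length x = m" "inc_chain P (nat n) x" "c \<le> num n" by blast
  \<comment> \<open>A negative \<open>n\<close> describes the empty chain; raising it to 0 keeps the
    chain and weakens the comparison with \<open>c\<close>.\<close>
  moreover have "num n \<le> num (int (nat n))" using assms by (simp add: strict_mono_less_eq)
  ultimately have "c \<le> num (int (nat n))" by simp
  moreover from x obtain \<Delta> where "\<Delta> \<in> tuple_sets m" "card \<Delta> = nat n" "\<forall>y\<in>\<Delta>. P y"
    using inc_chain_iff_set[of m P "nat n"] by blast
  ultimately show ?r by metis
next
  assume ?r
  then obtain \<Delta> where "\<Delta> \<in> tuple_sets m" "c \<le> num (int (card \<Delta>))" "\<forall>y\<in>\<Delta>. P y" by blast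
  moreover from this obtain x where "length x = m" "inc_chain P (card \<Delta>) x"
    using inc_chain_iff_set[of m P "card \<Delta>"] by blast
  ultimately show ?l by (metis nat_int)
qed

lemma at_most_iff_set:
  assumes "strict_mono num"
  shows "(\<forall>x n. length x = m \<and> inc_chain P (nat n) x \<longrightarrow> num n \<le> c) \<longleftrightarrow>
    (\<forall>\<Delta>\<in>tuple_sets m. \<not> num (int (card \<Delta>)) \<le> c \<longrightarrow> \<not> (\<forall>y\<in>\<Delta>. P y))" (is "?l \<longleftrightarrow> ?r")
proof
  assume l: ?l
  show ?r
  proof (intro ballI impI notI)
    fix \<Delta> assume "\<Delta> \<in> tuple_sets m" "\<not> num (int (card \<Delta>)) \<le> c" "\<forall>y\<in>\<Delta>. P y"
    moreover from this obtain x where "length x = m" "inc_chain P (card \<Delta>) x"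
      using inc_chain_iff_set[of m P "card \<Delta>"] by blast
    ultimately show False using l by (metis nat_int)
  qed
next
  assume r: ?r
  show ?l
  proof (intro allI impI)
    fix x n assume x: "length x = m \<and> inc_chain P (nat n) x"
    \<comment> \<open>For negative \<open>n\<close> the empty set of tuples already bounds
      \<open>num 0\<close>, hence \<open>num n\<close>.\<close>
    have "num n \<le> num (int (nat n))" using assms by (simp add: strict_mono_less_eq)
    moreover from x obtain \<Delta> where "\<Delta> \<in> tuple_sets m" "card \<Delta> = nat n" "\<forall>y\<in>\<Delta>. P y"
      using inc_chain_iff_set[of m P "nat n"] by blast
    ultimately show "num n \<le> c" using r by (metis order_trans)
  qed
qed

lemma fsat_bstar:
  fixes b :: "'c::linorder belem"
  assumes num: "strict_mono num" and e: "proper num e" and HT: "H \<subseteq> T" and wf: "wf_belem b"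
    and pure: "\<And>X L op t. b = BAgg X L op t \<Longrightarrow> set X \<inter> G = {}"
  shows "fsat num (fst (bstar num G b k)) H T e \<longleftrightarrow>
    iht (tau_belem num G (\<lambda>v. e (pv v)) b :: ('c, 'x) inf) H T"
proof (cases b)
  case (BL l)
  then show ?thesis using fsat_tauB_lc[OF num e] by simp
next
  case (BAgg X L op t)
  let ?Vs = "map pv (sorted_list_of_set (\<Union> (lcvars ` set L) \<inter> G))"
  let ?Ws = "map pv (sorted_list_of_set (\<Union> (lcvars ` set L) - G - set X))"
  let ?\<sigma> = "\<lambda>v. e (pv v)"
  let ?agg = "aggG num G ?\<sigma> X L :: 'c list \<Rightarrow> ('c, 'x) inf"
  obtain Ls k1 where Ls: "tauB_lcs num L k = (Ls, k1)" by force
  let ?F = "FExs ?Ws (FAnds Ls)" and ?C = "fg k1"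
  obtain A k2 where A: "valt num t ?C (Suc k1) = (A, k2)" by force
  let ?P = "case op of AGe \<Rightarrow> FAtleast (map pv X) ?Vs ?F (map FVar ?Vs @ [FVar ?C])
      | ALe \<Rightarrow> FAtmost (map pv X) ?Vs ?F (map FVar ?Vs @ [FVar ?C])"
  have X: "distinct X" "set X \<inter> G = {}" using wf pure BAgg by auto
  have C: "fsat num A H T (e(?C := c)) \<longleftrightarrow> c \<in> pval num ?\<sigma> t" for c
    using fsat_valt[OF num proper_upd[OF e], of ?C c ?C "Suc k1" t H T] A by simp
  have Vs: "map (e(?C := c)) ?Vs = map e ?Vs" for c by simp
  have F: "inc_chain (\<lambda>x. fsat num ?F H' T (upds (\<lambda>_. num 0) (map pv X @ ?Vs) (x @ map e ?Vs))) n x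
      \<longleftrightarrow> inc_chain (\<lambda>x. iht (?agg x) H' T) n x" if "length x = length X" for H' n x
    using that fsat_agg_element[OF num X, of _ L k H' T e, where 'x = 'x] Ls
    by (intro inc_chain_cong) simp
  have P: "fsat num ?P H T (e(?C := c)) \<longleftrightarrow> (case op of
      AGe \<Rightarrow> \<exists>\<Delta>\<in>tuple_sets (length X). c \<le> num (int (card \<Delta>)) \<and> (\<forall>x\<in>\<Delta>. iht (?agg x) H T)
    | ALe \<Rightarrow> \<forall>\<Delta>\<in>tuple_sets (length X). \<not> num (int (card \<Delta>)) \<le> c \<longrightarrow> \<not> (\<forall>x\<in>\<Delta>. iht (?agg x) T T))" for c
    by (cases op)
      (simp_all only: aggop.case fsat_FAtleast_vars fsat_FAtmost_vars Vs F length_map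
        std_term.simps fun_upd_same
        at_least_iff_set[OF num, symmetric] at_most_iff_set[OF num, symmetric] cong: conj_cong)
  have "fst (bstar num G b k) = FEx ?C (FAnd A ?P)"
    unfolding BAgg by (simp add: Ls A Let_def comp_def split: aggop.splits)
  then have "fsat num (fst (bstar num G b k)) H T e \<longleftrightarrow>
      (\<exists>c\<in>pval num ?\<sigma> t. fsat num ?P H T (e(?C := c)))"
    using C by (simp del: fun_upd_apply) blast
  \<comment> \<open>In the upper-bound case the negations in tau require failure at both worlds; by
    persistence failure at \<open>T\<close> is enough, as in the clause for
    \<open>FAtmost\<close>.\<close>
  also have "\<dots> \<longleftrightarrow> iht (tau_belem num G ?\<sigma> b :: ('c, 'x) inf) H T"
    unfolding P BAgg using iht_persistent[OF _ HT]
    by (cases op) (auto simp del: fun_upd_apply, blast+)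
  finally show ?thesis .
qed

section \<open>Bodies, rules and programs\<close>

lemma fsat_bstars:
  fixes B :: "'c::linorder belem list"
  assumes num: "strict_mono num" and e: "proper num e" and HT: "H \<subseteq> T"
    and "\<forall>b\<in>set B. wf_belem b" "\<forall>X L op t. BAgg X L op t \<in> set B \<longrightarrow> set X \<inter> G = {}"
  shows "(\<forall>A\<in>set (fst (bstars num G B k)). fsat num A H T e) \<longleftrightarrow>
    (\<forall>b\<in>set B. iht (tau_belem num G (\<lambda>v. e (pv v)) b :: ('c, 'x) inf) H T)"
  using assms(4,5)
proof (induction B arbitrary: k)
  case (Cons b B)
  obtain A k1 where A: "bstar num G b k = (A, k1)" by force
  obtain As k2 where As: "bstars num G B k1 = (As, k2)" by force
  have "fsat num A H T e \<longleftrightarrow> iht (tau_belem num G (\<lambda>v. e (pv v)) b :: ('c, 'x) inf) H T"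
    using fsat_bstar[OF num e HT, of b G k, where 'x = 'x] Cons.prems A by simp
  moreover have "(\<forall>A\<in>set As. fsat num A H T e) \<longleftrightarrow>
      (\<forall>b\<in>set B. iht (tau_belem num G (\<lambda>v. e (pv v)) b :: ('c, 'x) inf) H T)"
  proof -
    have "\<forall>b\<in>set B. wf_belem b" "\<forall>X L op t. BAgg X L op t \<in> set B \<longrightarrow> set X \<inter> G = {}"
      using Cons.prems by (meson list.set_intros(2))+
    from Cons.IH[OF this, of k1] show ?thesis by (simp add: As)
  qed
  ultimately show ?case using A As by simp
qed simp

text \<open>Program variables and fresh variables are disjoint, so their values can be prescribed
  independently; this turns a universal closure into tau's quantification over instances and value
  tuples.\<close>

lemma all_proper_iff:
  "(\<forall>e. proper num e \<longrightarrow> Q (\<lambda>v. e (pv v)) (map e (fresh_gs k n))) \<longleftrightarrow>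
    (\<forall>\<sigma> r. length r = n \<longrightarrow> Q \<sigma> r)"
proof (intro iffI allI impI)
  fix \<sigma> and r :: "'a list"
  assume all: "\<forall>e. proper num e \<longrightarrow> Q (\<lambda>v. e (pv v)) (map e (fresh_gs k n))"
    and r: "length r = n"
  \<comment> \<open>\<open>n div 2\<close> inverts the coding of program variables by even indices;
    the fresh variables have odd indices and are overwritten by \<open>r\<close>.\<close>
  let ?e = "upds (\<lambda>x. case x of GV n \<Rightarrow> \<sigma> (n div 2) | IV _ \<Rightarrow> num 0) (fresh_gs k n) r"
  have "proper num ?e"
    by (intro proper_upds_gvars) (auto simp: proper_def split: fvar.splits)
  moreover have "(\<lambda>v. ?e (pv v)) = \<sigma>" by (simp add: fun_eq_iff) (simp add: pv_def)
  moreover have "map ?e (fresh_gs k n) = r" using r by simp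
  ultimately show "Q \<sigma> r" using all by metis
next
  fix e :: "fvar \<Rightarrow> 'a"
  assume "\<forall>\<sigma> r. length r = n \<longrightarrow> Q \<sigma> r"
  then show "Q (\<lambda>v. e (pv v)) (map e (fresh_gs k n))" by simp
qed

text \<open>The first-order rule has the values of the head arguments in its antecedent, tau has a
  conjunction over them in its consequent. The forms agree since value sets do not depend on the
  world and the body does not depend on the fresh head variables.\<close>

lemma fsat_tau_star_rule:
  fixes R :: "'c::linorder rule"
  assumes num: "strict_mono num" and e0: "proper num e0" and HT: "H \<subseteq> T" and pure: "pure_rule symc R"
  shows "fsat num (tau_star_rule num R) H T e0 \<longleftrightarrow> iht (tau_rule num R :: ('c, 'x) inf) H T"
proof -
  obtain h B where R: "R = Rule h B" by (cases R)
  let ?G = "globals R"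
  obtain Bs k1 where Bs: "bstars num ?G B 0 = (Bs, k1)" by force
  define body where "body \<sigma> H' \<longleftrightarrow> (\<forall>b\<in>set B. iht (tau_belem num ?G \<sigma> b :: ('c, 'x) inf) H' T)" for \<sigma> H'
  have body: "(\<forall>A\<in>set Bs. fsat num A H' T e) \<longleftrightarrow> body (\<lambda>v. e (pv v)) H'"
    if "proper num e" "H' \<subseteq> T" for e H'
    unfolding body_def
    using fsat_bstars[OF num that, of B ?G 0, where 'x = 'x] pure Bs R by simp
  \<comment> \<open>Both kinds of head are treated at once. A choice head is automatic at
    \<open>T\<close>, while at \<open>H\<close> its negative disjunct demands absence from
    \<open>T\<close>, since \<open>H \<subseteq> T\<close>.\<close>
  have head: "(\<forall>e. proper num e \<longrightarrow> fsat num (head_star num ch (PAtom p ts) Bs k1) H T e) \<longleftrightarrow>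
     (\<forall>\<sigma>. \<forall>r\<in>pvals num \<sigma> ts. (body \<sigma> H \<longrightarrow> (p, r) \<in> H \<or> ch \<and> (p, r) \<notin> T)
        \<and> (body \<sigma> T \<longrightarrow> (p, r) \<in> T \<or> ch))" for ch p ts
  proof -
    let ?Zs = "fresh_gs k1 (length ts)"
    obtain As k2 where As: "valts num ts ?Zs (k1 + length ts) = (As, k2)" by force
    define Q where "Q \<sigma> r \<longleftrightarrow> (r \<in> pvals num \<sigma> ts \<longrightarrow>
        (body \<sigma> H \<longrightarrow> (p, r) \<in> H \<or> ch \<and> (p, r) \<notin> T) \<and> (body \<sigma> T \<longrightarrow> (p, r) \<in> T \<or> ch))" for \<sigma> r
    have "fsat num (head_star num ch (PAtom p ts) Bs k1) H T e \<longleftrightarrow> Q (\<lambda>v. e (pv v)) (map e ?Zs)"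
      if "proper num e" for e
    proof -
      have "(\<forall>A\<in>set As. fsat num A H' T e) \<longleftrightarrow> map e ?Zs \<in> pvals num (\<lambda>v. e (pv v)) ts" for H'
        using fsat_valts[OF num that, of ?Zs ts "k1 + length ts" H' T] As by simp
      then show ?thesis
        using body[OF that HT] body[OF that order_refl] HT
        by (auto simp: Let_def As ball_Un Q_def comp_def)
    qed
    then have "(\<forall>e. proper num e \<longrightarrow> fsat num (head_star num ch (PAtom p ts) Bs k1) H T e) \<longleftrightarrow>
        (\<forall>\<sigma> r. length r = length ts \<longrightarrow> Q \<sigma> r)"
      using all_proper_iff[of num Q k1 "length ts"] by blast
    then show ?thesis unfolding Q_def using pvals_length by blast
  qed
  have tau: "iht (tau_rule num R :: ('c, 'x) inf) H T \<longleftrightarrow>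
      (\<forall>\<sigma>. iht (tau_inst num ?G \<sigma> R :: ('c, 'x) inf) H T)"
    by (simp add: tau_rule_def)
  show ?thesis
  proof (cases h)
    case (HBasic a)
    obtain p ts where a: "a = PAtom p ts" by (cases a)
    have "fsat num (tau_star_rule num R) H T e0 \<longleftrightarrow>
        (\<forall>e. proper num e \<longrightarrow> fsat num (head_star num False (PAtom p ts) Bs k1) H T e)"
      using Bs fsat_uclose[OF e0] by (simp only: R tau_star_rule.simps HBasic a prod.case head.case)
    then show ?thesis unfolding tau head by (auto simp: R HBasic a body_def)
  next
    case (HChoice a)
    obtain p ts where a: "a = PAtom p ts" by (cases a)
    have "fsat num (tau_star_rule num R) H T e0 \<longleftrightarrow>
        (\<forall>e. proper num e \<longrightarrow> fsat num (head_star num True (PAtom p ts) Bs k1) H T e)"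
      using Bs fsat_uclose[OF e0] by (simp only: R tau_star_rule.simps HChoice a prod.case head.case)
    then show ?thesis unfolding tau head using HT by (auto simp: R HChoice a body_def)
  next
    case HNone
    have "fsat num (tau_star_rule num R) H T e0 \<longleftrightarrow>
        (\<forall>e. proper num e \<longrightarrow> fsat num (FNeg (FAnds Bs)) H T e)"
      using Bs fsat_uclose[OF e0] by (simp only: R tau_star_rule.simps HNone prod.case head.case)
    also have "\<dots> \<longleftrightarrow> (\<forall>e. proper num e \<longrightarrow> \<not> body (\<lambda>v. e (pv v)) H \<and> \<not> body (\<lambda>v. e (pv v)) T)"
      using body HT by simp
    also have "\<dots> \<longleftrightarrow> (\<forall>\<sigma>. \<not> body \<sigma> H \<and> \<not> body \<sigma> T)"
      using all_proper_iff[of num "\<lambda>\<sigma> _. \<not> body \<sigma> H \<and> \<not> body \<sigma> T" 0 0] by simp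
    finally show ?thesis unfolding tau by (simp add: R HNone body_def)
  qed
qed

lemma fsat_tau_star:
  fixes P :: "'c::linorder rule set"
  assumes "strict_mono num" "proper num e" "H \<subseteq> T" "program symc P"
  shows "fsat num (tau_star num P) H T e \<longleftrightarrow> iht (tau_prog num P :: ('c, 'x) inf) H T"
proof -
  have "finite P" using assms(4) by (simp add: program_def)
  then have "\<exists>rs. set rs = P \<and> distinct rs" using finite_distinct_list by blast
  then have "set (SOME rs. set rs = P \<and> distinct rs) = P"
    by (rule someI2_ex) simp
  then have "fsat num (tau_star num P) H T e \<longleftrightarrow> (\<forall>R\<in>P. fsat num (tau_star_rule num R) H T e)"
    by (simp add: tau_star_def)
  also have "\<dots> \<longleftrightarrow> (\<forall>R\<in>P. iht (tau_rule num R :: ('c, 'x) inf) H T)"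
    using fsat_tau_star_rule[OF assms(1-3)] assms(4) unfolding program_def by blast
  finally show ?thesis by (simp add: tau_prog_def)
qed

theorem theorem1:
  fixes num :: "int \<Rightarrow> 'c::linorder" and symc :: "'c set" and P1 P2 :: "'c rule set"
  assumes "precomp_ok num symc"
    and "program symc P1" and "program symc P2"
    and "ht_prov num symc (FIff (tau_star num P1) (tau_star num P2))"
  shows "strongly_equiv TYPE('x) num P1 P2"
proof -
  have num: "strict_mono num" using assms(1) by (simp add: precomp_ok_def)
  let ?e = "\<lambda>_. num 0"
  have e: "proper num ?e" by (simp add: proper_def)
  have equiv: "iht (tau_prog num P1 :: ('c, 'x) inf) H T \<longleftrightarrow> iht (tau_prog num P2 :: ('c, 'x) inf) H T"
    if "H \<subseteq> T" for H T
    using ht_prov_sound[OF num assms(4) e that]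
      fsat_tau_star[OF num e that assms(2), where 'x = 'x]
      fsat_tau_star[OF num e that assms(3), where 'x = 'x]
    by simp
  show ?thesis
    unfolding strongly_equiv_def by (intro allI stable_insert_cong equiv)
qed

end
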